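(* If $\kappa$ is a measurable cardinal with $2^\kappa=\kappa^+$ and $\mu$ is a normal measure on $\kappa$, then there is a well-founded ultrafilter $U$ on the Boolean algebra corresponding to $\mathrm{Add}(\kappa,1)$ such that the Boolean ultrapower by $U$ is the same as the ultrapower by $\mu$.
   Context: $V$ is the universe of sets (ZFC). $\mathrm{Add}(\kappa,1)$ is the forcing adding a Cohen subset of $\kappa$ with conditions of size less than $\kappa$; the corresponding Boolean algebra $\mathbb{B}$ is its regular open algebra. $U$ is an ultrafilter in $V$. $\mathbb{B}$-names (elements of $V^{\mathbb{B}}$) are defined recursively: $\tau$ is a $\mathbb{B}$-name if $\tau$ is a set of pairs $\langle\sigma,b\rangle$ with $\sigma$ a $\mathbb{B}$-name and $b\in\mathbb{B}$. Boolean values: $[\![\tau\in\sigma]\!]=\bigvee_{\langle\eta,b\rangle\in\sigma}[\![\tau=\eta]\!]\wedge b$, $[\![\tau=\sigma]\!]=[\![\tau\subseteq\sigma]\!]\wedge[\![\sigma\subseteq\tau]\!]$, $[\![\tau\subseteq\sigma]\!]=\bigwedge_{\eta\in\mathrm{dom}(\tau)}(\neg[\![\eta\in\tau]\!]\vee[\![\eta\in\sigma]\!])$. For $x\in V$, $\check x=\{\langle\check y,1\rangle : y\in x\}$; $[\![\tau\in\check V]\!]=\bigvee_{x\in V}[\![\tau=\check x]\!]$. Let $\tau=_U\sigma$ iff $[\![\tau=\sigma]\!]\in U$, $\tau\in_U\sigma$ iff $[\![\tau\in\sigma]\!]\in U$; $[\tau]_U$ is the $=_U$-class of $\tau$ (restricted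 to members of minimal rank). The Boolean ultrapower is $\check V_U=\{[\tau]_U : [\![\tau\in\check V]\!]\in U\}$ under $\in_U$, with elementary embedding $j_U:V\to\check V_U$, $j_U(x)=[\check x]_U$. $U$ is well-founded if $\check V_U$ is well-founded, and then $\check V_U$ is identified with its transitive collapse. "The Boolean ultrapower by $U$ is the same as the ultrapower by $\mu$" means $j_U=j_\mu$, where $j_\mu:V\to M$ is the classical ultrapower embedding by $\mu$ into the transitive collapse $M$ of $V^\kappa/\mu$. *)

theory Defs
  imports
    "HOL-Analysis.Abstract_Topology"
    "HOL-Library.Equipollence"
    "HOL-Library.FuncSet"
    "HOL-Library.Multiset"
begin

unbundle cardinal_syntax

section \<open>The universe of sets\<close>

text \<open>
  A type of this class is a universe \<open>V\<close> of ZFC; \<open>elts x\<close> is the extension of the set \<open>x\<close>, and a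
  class is an arbitrary HOL set of elements of \<open>V\<close>. Separation and replacement hold for arbitrary
  HOL predicates and functions, and the axiom of choice follows from them and Hilbert choice.
  Consequently every HOL subset of some \<open>elts x\<close>, and every HOL function on some \<open>elts x\<close>, is
  represented by an element of \<open>V\<close>. Cardinality, well-foundedness and subset quantification may
  therefore be expressed with the HOL notions.
\<close>

class zfc_universe =
  fixes elts :: "'a \<Rightarrow> 'a set"
  assumes extensionality: "elts x = elts y \<Longrightarrow> x = y"
    and foundation: "wf {(x, y). x \<in> elts y}"
    and empty_set: "\<exists>z. elts z = {}"
    and pairing: "\<exists>z. elts z = {x, y}"
    and union: "\<exists>z. elts z = \<Union> (elts ` elts x)"
    and powerset: "\<exists>z. elts z = {y. elts y \<subseteq> elts x}"
    and infinity: "\<exists>z. (\<exists>e \<in> elts z. elts e = {}) \<and>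
      (\<forall>x \<in> elts z. \<exists>y \<in> elts z. elts y = insert x (elts x))"
    and separation: "\<exists>z. elts z = {y \<in> elts x. P y}"
    and replacement: "\<exists>z. elts z = f ` elts x"

text \<open>\<open>vset A\<close> is the set with extension \<open>A\<close>; it is meaningful only if \<open>A\<close> is not a proper class.\<close>

definition vset :: "'v set \<Rightarrow> 'v::zfc_universe"
  where "vset A = (THE x. elts x = A)"

definition vpair :: "'v \<Rightarrow> 'v \<Rightarrow> 'v::zfc_universe"
  where "vpair x y = vset {vset {x}, vset {x, y}}"

lemma vset_elts [simp]: "vset (elts x) = x"
  unfolding vset_def by (rule the_equality) (auto intro: extensionality)

lemma elts_vset_pair [simp]: "elts (vset {x, y}) = {x, y}"
  using pairing[of x y] by (metis vset_elts)

lemma elts_vset_singleton [simp]: "elts (vset {x}) = {x}"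
  using elts_vset_pair[of x x] by simp

abbreviation mem_rel :: "'v::zfc_universe rel"
  where "mem_rel \<equiv> {(x, y). x \<in> elts y}"

lemma vpair_mem_imp_trancl:
  assumes "vpair \<eta> b \<in> elts \<tau>"
  shows "(\<eta>, \<tau>) \<in> mem_rel\<^sup>+"
proof -
  have "(\<eta>, vset {\<eta>}) \<in> mem_rel" "(vset {\<eta>}, vpair \<eta> b) \<in> mem_rel" "(vpair \<eta> b, \<tau>) \<in> mem_rel"
    using assms by (auto simp: vpair_def)
  then show ?thesis by (meson trancl.r_into_trancl trancl_into_trancl)
qed

section \<open>Measurable cardinals and normal measures\<close>

definition transitive_set :: "'v::zfc_universe \<Rightarrow> bool"
  where "transitive_set x \<longleftrightarrow> (\<forall>y \<in> elts x. elts y \<subseteq> elts x)"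

definition ordinal :: "'v::zfc_universe \<Rightarrow> bool"
  where "ordinal x \<longleftrightarrow> transitive_set x \<and> (\<forall>y \<in> elts x. transitive_set y)"

definition cardinal :: "'v::zfc_universe \<Rightarrow> bool"
  where "cardinal \<kappa> \<longleftrightarrow> ordinal \<kappa> \<and> (\<forall>\<alpha> \<in> elts \<kappa>. \<not> elts \<alpha> \<approx> elts \<kappa>)"

text \<open>
  Ultrafilters on a Boolean algebra \<open>B\<close> of sets, ordered by inclusion, in which meets are
  intersections and complementation is \<open>neg\<close>. Joins need not be unions.
\<close>

definition ultrafilter_on :: "'a set set \<Rightarrow> ('a set \<Rightarrow> 'a set) \<Rightarrow> 'a set set \<Rightarrow> bool"
  where "ultrafilter_on B neg U \<longleftrightarrow>
    U \<subseteq> B \<and> U \<noteq> {} \<and> {} \<notin> U \<and>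
    (\<forall>a \<in> U. \<forall>b \<in> U. a \<inter> b \<in> U) \<and>
    (\<forall>a \<in> U. \<forall>b \<in> B. a \<subseteq> b \<longrightarrow> b \<in> U) \<and>
    (\<forall>b \<in> B. b \<in> U \<or> neg b \<in> U)"

definition complete_nonprincipal_ultrafilter :: "'v::zfc_universe \<Rightarrow> 'v set set \<Rightarrow> bool"
  where "complete_nonprincipal_ultrafilter \<kappa> \<mu> \<longleftrightarrow>
    ultrafilter_on (Pow (elts \<kappa>)) (\<lambda>X. elts \<kappa> - X) \<mu> \<and>
    (\<forall>\<alpha> \<in> elts \<kappa>. {\<alpha>} \<notin> \<mu>) \<and>
    (\<forall>F. F \<subseteq> \<mu> \<and> F \<noteq> {} \<and> F \<prec> elts \<kappa> \<longrightarrow> \<Inter>F \<in> \<mu>)"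

definition measurable_cardinal :: "'v::zfc_universe \<Rightarrow> bool"
  where "measurable_cardinal \<kappa> \<longleftrightarrow>
    cardinal \<kappa> \<and> uncountable (elts \<kappa>) \<and> (\<exists>\<mu>. complete_nonprincipal_ultrafilter \<kappa> \<mu>)"

text \<open>Normality is closure under diagonal intersections; \<open>\<alpha> < \<beta>\<close> is \<open>\<alpha> \<in> elts \<beta>\<close>.\<close>

definition normal_measure :: "'v::zfc_universe \<Rightarrow> 'v set set \<Rightarrow> bool"
  where "normal_measure \<kappa> \<mu> \<longleftrightarrow>
    complete_nonprincipal_ultrafilter \<kappa> \<mu> \<and>
    (\<forall>A. (\<forall>\<alpha> \<in> elts \<kappa>. A \<alpha> \<in> \<mu>) \<longrightarrow> {\<beta> \<in> elts \<kappa>. \<forall>\<alpha> \<in> elts \<beta>. \<beta> \<in> A \<alpha>} \<in> \<mu>)"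

section \<open>Quotients and transitive collapse\<close>

text \<open>
  Quotient classes are HOL sets and may be proper classes, so the restriction to members of
  minimal rank is not needed.
\<close>

definition quot_class :: "'d set \<Rightarrow> ('d \<Rightarrow> 'd \<Rightarrow> bool) \<Rightarrow> 'd \<Rightarrow> 'd set"
  where "quot_class D eq x = {y \<in> D. eq x y}"

definition quot_mem :: "'d set \<Rightarrow> ('d \<Rightarrow> 'd \<Rightarrow> bool) \<Rightarrow> ('d \<Rightarrow> 'd \<Rightarrow> bool) \<Rightarrow> 'd set rel"
  where "quot_mem D eq mem =
    {(quot_class D eq x, quot_class D eq y) | x y. x \<in> D \<and> y \<in> D \<and> mem x y}"

text \<open>Meaningful if \<open>E\<close> is well-founded and its sets of predecessors are small.\<close>

definition collapse :: "'d rel \<Rightarrow> 'd \<Rightarrow> 'v::zfc_universe"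
  where "collapse E = wfrec E (\<lambda>\<pi> x. vset (\<pi> ` {y. (y, x) \<in> E}))"

section \<open>The classical ultrapower\<close>

definition up_dom :: "'v \<Rightarrow> ('v \<Rightarrow> 'v::zfc_universe) set"
  where "up_dom \<kappa> = elts \<kappa> \<rightarrow>\<^sub>E UNIV"

definition up_eq :: "'v \<Rightarrow> 'v set set \<Rightarrow> ('v \<Rightarrow> 'v) \<Rightarrow> ('v \<Rightarrow> 'v::zfc_universe) \<Rightarrow> bool"
  where "up_eq \<kappa> \<mu> f g \<longleftrightarrow> {\<alpha> \<in> elts \<kappa>. f \<alpha> = g \<alpha>} \<in> \<mu>"

definition up_mem :: "'v \<Rightarrow> 'v set set \<Rightarrow> ('v \<Rightarrow> 'v) \<Rightarrow> ('v \<Rightarrow> 'v::zfc_universe) \<Rightarrow> bool"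
  where "up_mem \<kappa> \<mu> f g \<longleftrightarrow> {\<alpha> \<in> elts \<kappa>. f \<alpha> \<in> elts (g \<alpha>)} \<in> \<mu>"

definition up_embedding :: "'v \<Rightarrow> 'v set set \<Rightarrow> 'v \<Rightarrow> 'v::zfc_universe"
  where "up_embedding \<kappa> \<mu> x =
    collapse (quot_mem (up_dom \<kappa>) (up_eq \<kappa> \<mu>) (up_mem \<kappa> \<mu>))
      (quot_class (up_dom \<kappa>) (up_eq \<kappa> \<mu>) (\<lambda>\<alpha> \<in> elts \<kappa>. x))"

section \<open>Regular open algebras\<close>

definition regular_opens :: "'a topology \<Rightarrow> 'a set set"
  where "regular_opens X = {b. openin X b \<and> X interior_of (X closure_of b) = b}"

definition ro_Sup :: "'a topology \<Rightarrow> 'a set set \<Rightarrow> 'a set"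
  where "ro_Sup X A = X interior_of (X closure_of \<Union>A)"

definition ro_Inf :: "'a topology \<Rightarrow> 'a set set \<Rightarrow> 'a set"
  where "ro_Inf X A = X interior_of (topspace X \<inter> \<Inter>A)"

definition ro_join :: "'a topology \<Rightarrow> 'a set \<Rightarrow> 'a set \<Rightarrow> 'a set"
  where "ro_join X a b = ro_Sup X {a, b}"

definition ro_neg :: "'a topology \<Rightarrow> 'a set \<Rightarrow> 'a set"
  where "ro_neg X b = X interior_of (topspace X - b)"

section \<open>Boolean-valued names\<close>

text \<open>
  From here on, Boolean values are regular open sets of points of \<open>X\<close>. In a name, the value
  \<open>b\<close> occurs as the element of \<open>V\<close> whose extension it is.
\<close>

inductive is_name :: "'v::zfc_universe topology \<Rightarrow> 'v \<Rightarrow> bool" for X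
  where "(\<And>p. p \<in> elts \<tau> \<Longrightarrow> \<exists>\<sigma> b. p = vpair \<sigma> b \<and> is_name X \<sigma> \<and> elts b \<in> regular_opens X)
    \<Longrightarrow> is_name X \<tau>"

definition name_dom :: "'v::zfc_universe \<Rightarrow> 'v set"
  where "name_dom \<tau> = {\<eta>. \<exists>b. vpair \<eta> b \<in> elts \<tau>}"

function
  bval_mem :: "'v::zfc_universe topology \<Rightarrow> 'v \<Rightarrow> 'v \<Rightarrow> 'v set" and
  bval_eq :: "'v topology \<Rightarrow> 'v \<Rightarrow> 'v \<Rightarrow> 'v set" and
  bval_sub :: "'v topology \<Rightarrow> 'v \<Rightarrow> 'v \<Rightarrow> 'v set"
  where
    "bval_mem X \<tau> \<sigma> =
      ro_Sup X ((\<lambda>(\<eta>, b). bval_eq X \<tau> \<eta> \<inter> elts b) ` {(\<eta>, b). vpair \<eta> b \<in> elts \<sigma>})"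
  | "bval_eq X \<tau> \<sigma> = bval_sub X \<tau> \<sigma> \<inter> bval_sub X \<sigma> \<tau>"
  | "bval_sub X \<tau> \<sigma> =
      ro_Inf X ((\<lambda>\<eta>. ro_join X (ro_neg X (bval_mem X \<eta> \<tau>)) (bval_mem X \<eta> \<sigma>)) ` name_dom \<tau>)"
  by pat_completeness auto

text \<open>
  The recursive calls decrease the multisets \<open>{\<tau>, \<tau>, \<sigma>}\<close> (for \<open>bval_mem\<close> and \<open>bval_sub\<close>) and
  \<open>{\<tau>, \<tau>, \<sigma>, \<sigma>}\<close> (for \<open>bval_eq\<close>) in the multiset extension of the transitive closure of membership.
\<close>

context
begin

private definition bval_measure ::
    "('v::zfc_universe topology \<times> 'v \<times> 'v) + (('v topology \<times> 'v \<times> 'v) + ('v topology \<times> 'v \<times> 'v))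
      \<Rightarrow> 'v multiset"
  where "bval_measure c = (case c of
      Inl (_, \<tau>, \<sigma>) \<Rightarrow> {#\<tau>, \<tau>, \<sigma>#}
    | Inr (Inl (_, \<tau>, \<sigma>)) \<Rightarrow> {#\<tau>, \<tau>, \<sigma>, \<sigma>#}
    | Inr (Inr (_, \<tau>, \<sigma>)) \<Rightarrow> {#\<tau>, \<tau>, \<sigma>#})"

private lemma mult_steps:
  fixes R :: "'v rel"
  shows "(\<eta>, \<sigma>) \<in> R \<Longrightarrow> ({#\<tau>, \<tau>, \<eta>, \<eta>#}, {#\<tau>, \<tau>, \<sigma>#}) \<in> mult R"
    and "({#\<tau>, \<tau>, \<sigma>#}, {#\<tau>, \<tau>, \<sigma>, \<sigma>#}) \<in> mult R"
    and "({#\<sigma>, \<sigma>, \<tau>#}, {#\<tau>, \<tau>, \<sigma>, \<sigma>#}) \<in> mult R"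
    and "(\<eta>, \<tau>) \<in> R \<Longrightarrow> ({#\<eta>, \<eta>, \<tau>#}, {#\<tau>, \<tau>, \<sigma>#}) \<in> mult R"
    and "(\<eta>, \<tau>) \<in> R \<Longrightarrow> ({#\<eta>, \<eta>, \<sigma>#}, {#\<tau>, \<tau>, \<sigma>#}) \<in> mult R"
  using one_step_implies_mult[of "{#\<sigma>#}" "{#\<eta>, \<eta>#}" R "{#\<tau>, \<tau>#}"]
    one_step_implies_mult[of "{#\<sigma>#}" "{#}" R "{#\<tau>, \<tau>, \<sigma>#}"]
    one_step_implies_mult[of "{#\<tau>#}" "{#}" R "{#\<sigma>, \<sigma>, \<tau>#}"]
    one_step_implies_mult[of "{#\<tau>, \<sigma>#}" "{#\<eta>, \<eta>#}" R "{#\<tau>#}"]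
    one_step_implies_mult[of "{#\<tau>, \<tau>#}" "{#\<eta>, \<eta>#}" R "{#\<sigma>#}"]
  by (auto simp: add_mset_commute)

termination
proof (relation "inv_image (mult (mem_rel\<^sup>+)) bval_measure", goal_cases)
  case 1
  then show ?case by (intro wf_inv_image wf_mult wf_trancl foundation)
qed (auto simp: bval_measure_def name_dom_def mult_steps dest: vpair_mem_imp_trancl)

end

declare bval_mem.simps [simp del] bval_eq.simps [simp del] bval_sub.simps [simp del]

function check_name :: "'v::zfc_universe topology \<Rightarrow> 'v \<Rightarrow> 'v"
  where "check_name X x = vset ((\<lambda>y. vpair (check_name X y) (vset (topspace X))) ` elts x)"
  by pat_completeness auto
termination
  by (relation "inv_image mem_rel snd") (auto simp: foundation)

declare check_name.simps [simp del]

definition bval_ground :: "'v::zfc_universe topology \<Rightarrow> 'v \<Rightarrow> 'v set"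
  where "bval_ground X \<tau> = ro_Sup X (range (\<lambda>x. bval_eq X \<tau> (check_name X x)))"

section \<open>The Boolean ultrapower\<close>

definition bup_dom :: "'v::zfc_universe topology \<Rightarrow> 'v set set \<Rightarrow> 'v set"
  where "bup_dom X U = {\<tau>. is_name X \<tau> \<and> bval_ground X \<tau> \<in> U}"

definition bup_mem_rel :: "'v::zfc_universe topology \<Rightarrow> 'v set set \<Rightarrow> 'v set rel"
  where "bup_mem_rel X U =
    quot_mem (bup_dom X U) (\<lambda>\<tau> \<sigma>. bval_eq X \<tau> \<sigma> \<in> U) (\<lambda>\<tau> \<sigma>. bval_mem X \<tau> \<sigma> \<in> U)"

definition well_founded_ultrafilter :: "'v::zfc_universe topology \<Rightarrow> 'v set set \<Rightarrow> bool"
  where "well_founded_ultrafilter X U \<longleftrightarrow>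
    ultrafilter_on (regular_opens X) (ro_neg X) U \<and> wf (bup_mem_rel X U)"

definition bup_embedding :: "'v::zfc_universe topology \<Rightarrow> 'v set set \<Rightarrow> 'v \<Rightarrow> 'v"
  where "bup_embedding X U x =
    collapse (bup_mem_rel X U)
      (quot_class (bup_dom X U) (\<lambda>\<tau> \<sigma>. bval_eq X \<tau> \<sigma> \<in> U) (check_name X x))"

section \<open>The forcing adding a Cohen subset\<close>

text \<open>Partial functions from \<open>\<kappa>\<close> to \<open>2 = {0, {0}}\<close> of size less than \<open>\<kappa>\<close>, as sets of pairs.\<close>

definition cohen_conditions :: "'v::zfc_universe \<Rightarrow> 'v set"
  where "cohen_conditions \<kappa> = {p.
    elts p \<subseteq> {vpair \<alpha> i | \<alpha> i. \<alpha> \<in> elts \<kappa> \<and> i \<in> {vset {}, vset {vset {}}}} \<and>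
    (\<forall>\<alpha> i j. vpair \<alpha> i \<in> elts p \<and> vpair \<alpha> j \<in> elts p \<longrightarrow> i = j) \<and>
    elts p \<prec> elts \<kappa>}"

text \<open>
  The open sets are those closed under passing to stronger conditions, a condition being stronger
  if it is a larger partial function.
\<close>

definition cohen_topology :: "'v::zfc_universe \<Rightarrow> 'v topology"
  where "cohen_topology \<kappa> = topology (\<lambda>S. S \<subseteq> cohen_conditions \<kappa> \<and>
    (\<forall>p \<in> S. \<forall>q \<in> cohen_conditions \<kappa>. elts p \<subseteq> elts q \<longrightarrow> q \<in> S))"

lemma openin_cohen_topology:
  "openin (cohen_topology \<kappa>) S \<longleftrightarrow> S \<subseteq> cohen_conditions \<kappa> \<and>
    (\<forall>p \<in> S. \<forall>q \<in> cohen_conditions \<kappa>. elts p \<subseteq> elts q \<longrightarrow> q \<in> S)"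
proof -
  have "istopology (\<lambda>S. S \<subseteq> cohen_conditions \<kappa> \<and>
    (\<forall>p \<in> S. \<forall>q \<in> cohen_conditions \<kappa>. elts p \<subseteq> elts q \<longrightarrow> q \<in> S))"
    unfolding istopology_def by blast
  then show ?thesis
    unfolding cohen_topology_def by simp
qed

end

theory Submission
  imports Defs
begin

text \<open>
  Let \<open>j\<close> be the ultrapower embedding by \<open>\<mu>\<close>, with target \<open>M\<close>. If \<open>G\<close> is an \<open>M\<close>-generic filter for
  \<open>j(Add(\<kappa>, 1))\<close>, then \<open>U = {b. j(b) \<in> G}\<close> is an ultrafilter, and evaluating \<open>j(\<tau>)\<close> by \<open>G\<close> embeds the
  Boolean ultrapower by \<open>U\<close> into \<open>M\<close>. Every element of \<open>M\<close> is \<open>j(f)(\<kappa>)\<close> for some \<open>f\<close> on \<open>\<kappa>\<close>, so this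
  embedding is onto as soon as \<open>\<kappa>\<close> is the value of a name for a ground-model element. That is arranged
  by making \<open>\<kappa>\<close> the first place at which the generic subset of \<open>j(\<kappa>)\<close> takes the value \<open>1\<close>.

  The proof carries this out inside \<open>V\<close>, with functions on \<open>\<kappa>\<close> in place of elements of \<open>M\<close>. A condition
  of \<open>j(Add(\<kappa>, 1))\<close> becomes a function \<open>q\<close> from \<open>\<kappa>\<close> to Cohen conditions, ordered modulo \<open>\<mu>\<close>; only those
  are used for which \<open>q \<alpha>\<close> decides that \<open>\<alpha>\<close> is the first place with value \<open>1\<close> (\<open>rooted\<close>). A
  descending family of at most \<open>\<kappa>\<close> such functions has a lower bound, by normality (\<open>rooted_closed\<close>).
  Since \<open>\<kappa>\<close> is inaccessible, there are only \<open>\<kappa>\<close> Cohen conditions (\<open>card_conditions\<close>), hence at most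
  \<open>2\<^sup>\<kappa> = \<kappa>\<^sup>+\<close> dense open sets of them, and a chain \<open>G\<close> of length at most \<open>\<kappa>\<^sup>+\<close> meets all the corresponding
  requirements (\<open>generic_exists\<close>). Full genericity over \<open>M\<close> would involve sequences of dense sets;
  constant sequences are enough here.

  A regular open set belongs to \<open>U\<close> if some \<open>q\<close> in \<open>G\<close> takes values in it almost everywhere. A name \<open>\<tau>\<close>
  is represented by \<open>f\<close> if, for some \<open>q\<close> in \<open>G\<close>, almost every \<open>q \<alpha>\<close> forces \<open>\<tau>\<close> to equal the ground-model
  set \<open>f \<alpha>\<close>. Under this relation equality and membership modulo \<open>U\<close> correspond to equality and
  membership modulo \<open>\<mu>\<close> (\<open>represents_eq_iff\<close>, \<open>represents_mem_iff\<close>). Genericity represents every name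
  in the Boolean ultrapower (\<open>represented_by_function\<close>), and mixing along the antichain of possible first
  places represents every function (\<open>function_represents_name\<close>). So the two quotient structures are
  isomorphic and have the same collapse (\<open>quotient_correspondence\<close>), with the name of \<open>x\<close> matched to the
  constant function \<open>x\<close>.
\<close>

section \<open>Small classes and pairs\<close>

text \<open>
  The classes that are sets. For them \<open>vset\<close> has the expected extension.
\<close>

definition small :: "'v::zfc_universe set \<Rightarrow> bool"
  where "small A \<longleftrightarrow> (\<exists>z. elts z = A)"

lemma small_elts [simp]: "small (elts x)"
  unfolding small_def by blast

lemma elts_vset [simp]: "small A \<Longrightarrow> elts (vset A) = A"
  unfolding small_def by auto

lemma small_subset: "small A \<Longrightarrow> B \<subseteq> A \<Longrightarrow> small B"
proof -
  assume "small A" "B \<subseteq> A"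
  then obtain z where "elts z = A"
    unfolding small_def by blast
  then have "B = {y \<in> elts z. y \<in> B}"
    using \<open>B \<subseteq> A\<close> by blast
  then show "small B"
    unfolding small_def using separation[of z "\<lambda>y. y \<in> B"] by auto
qed

lemma small_image: "small A \<Longrightarrow> small (f ` A)" for f :: "'v::zfc_universe \<Rightarrow> 'v"
  unfolding small_def using replacement[of f] by blast

lemma small_Union: "small A \<Longrightarrow> small (\<Union> (elts ` A))"
  unfolding small_def using union by blast

lemma small_UN:
  fixes B :: "'v::zfc_universe \<Rightarrow> 'v set"
  assumes "small A" "\<And>x. x \<in> A \<Longrightarrow> small (B x)"
  shows "small (\<Union>x\<in>A. B x)"
proof -
  have "(\<Union>x\<in>A. B x) = \<Union> (elts ` (\<lambda>x. vset (B x)) ` A)"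
    using assms(2) by auto
  then show ?thesis
    using small_Union[OF small_image[OF assms(1)]] by metis
qed

lemma small_Un: "small A \<Longrightarrow> small B \<Longrightarrow> small (A \<union> B)"
  using small_Union[of "{vset A, vset B}"] pairing[of "vset A" "vset B"]
  by (auto simp: small_def)

lemma small_insert: "small A \<Longrightarrow> small (insert x A)"
  using small_Un[of "{x}" A] small_elts[of "vset {x}"] by simp

lemma small_empty: "small {}"
  unfolding small_def by (rule empty_set)

lemma small_Pow: "small A \<Longrightarrow> small {x. elts x \<subseteq> A}"
  unfolding small_def using powerset by blast

text \<open>
  Applying \<open>elts\<close> twice to a Kuratowski pair turns the equation into one between finite HOL sets.
\<close>

lemma vpair_inject [simp]: "vpair x y = vpair x' y' \<longleftrightarrow> x = x' \<and> y = y'"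
proof
  assume "vpair x y = vpair x' y'"
  then have "elts ` elts (vpair x y) = elts ` elts (vpair x' y')"
    by simp
  then have "{{x}, {x, y}} = {{x'}, {x', y'}}"
    by (simp add: vpair_def)
  then show "x = x' \<and> y = y'"
    by (auto simp: doubleton_eq_iff)
qed simp

section \<open>Forcing with regular open sets\<close>

text \<open>
  For the topology of sets closed under stronger conditions, the least neighbourhood of a condition \<open>p\<close>
  is the set of its extensions. Membership of \<open>p\<close> in a Boolean value is therefore the forcing relation
  at \<open>p\<close>, and the Boolean operations become the usual forcing clauses. This replaces calculation with
  infinite joins and meets by arguments about extensions of conditions. Here \<open>q \<unlhd> p\<close> means that
  \<open>q\<close> is stronger than \<open>p\<close>.
\<close>

locale forcing =
  fixes P :: "'v::zfc_universe set" and ext :: "'v \<Rightarrow> 'v \<Rightarrow> bool" (infix "\<unlhd>" 50)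
    and X :: "'v topology"
  assumes openin_iff: "openin X S \<longleftrightarrow> S \<subseteq> P \<and> (\<forall>p\<in>S. \<forall>q\<in>P. q \<unlhd> p \<longrightarrow> q \<in> S)"
    and ext_refl [simp]: "p \<unlhd> p"
    and ext_trans: "r \<unlhd> q \<Longrightarrow> q \<unlhd> p \<Longrightarrow> r \<unlhd> p"
    and small_P: "small P"
begin

lemma topspace_eq: "topspace X = P"
proof -
  have "openin X P"
    by (auto simp: openin_iff)
  then show ?thesis
    using openin_iff[of "topspace X"] openin_subset by blast
qed

lemma openin_mono: "openin X b \<Longrightarrow> p \<in> b \<Longrightarrow> q \<in> P \<Longrightarrow> q \<unlhd> p \<Longrightarrow> q \<in> b"
  by (auto simp: openin_iff)

lemma openin_cone: "openin X {q \<in> P. q \<unlhd> p}"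
  by (auto simp: openin_iff intro: ext_trans)

lemma in_interior_iff: "p \<in> X interior_of S \<longleftrightarrow> p \<in> P \<and> (\<forall>q\<in>P. q \<unlhd> p \<longrightarrow> q \<in> S)"
proof
  assume "p \<in> X interior_of S"
  then show "p \<in> P \<and> (\<forall>q\<in>P. q \<unlhd> p \<longrightarrow> q \<in> S)"
    by (auto simp: interior_of_def openin_iff)
next
  assume "p \<in> P \<and> (\<forall>q\<in>P. q \<unlhd> p \<longrightarrow> q \<in> S)"
  then have "{q \<in> P. q \<unlhd> p} \<subseteq> S" "p \<in> {q \<in> P. q \<unlhd> p}"
    by auto
  then show "p \<in> X interior_of S"
    using interior_of_maximal[OF _ openin_cone] by blast
qed

lemma in_closure_iff: "p \<in> X closure_of S \<longleftrightarrow> p \<in> P \<and> (\<exists>q\<in>P. q \<unlhd> p \<and> q \<in> S)"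
proof
  assume "p \<in> X closure_of S"
  then show "p \<in> P \<and> (\<exists>q\<in>P. q \<unlhd> p \<and> q \<in> S)"
    using openin_cone[of p] unfolding in_closure_of topspace_eq
    by (metis (mono_tags, lifting) ext_refl mem_Collect_eq)
next
  assume "p \<in> P \<and> (\<exists>q\<in>P. q \<unlhd> p \<and> q \<in> S)"
  then show "p \<in> X closure_of S"
    by (auto simp: in_closure_of topspace_eq openin_iff)
qed

lemma in_ro_Sup_iff:
  "p \<in> ro_Sup X A \<longleftrightarrow> p \<in> P \<and> (\<forall>q\<in>P. q \<unlhd> p \<longrightarrow> (\<exists>r\<in>P. r \<unlhd> q \<and> r \<in> \<Union>A))"
  by (auto simp: ro_Sup_def in_interior_iff in_closure_iff)

lemma in_ro_neg_iff: "p \<in> ro_neg X b \<longleftrightarrow> p \<in> P \<and> (\<forall>q\<in>P. q \<unlhd> p \<longrightarrow> q \<notin> b)"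
  by (auto simp: ro_neg_def in_interior_iff topspace_eq)

lemma in_ro_Inf_iff:
  assumes "\<And>a. a \<in> A \<Longrightarrow> openin X a"
  shows "p \<in> ro_Inf X A \<longleftrightarrow> p \<in> P \<and> (\<forall>a\<in>A. p \<in> a)"
  using assms by (auto simp: ro_Inf_def in_interior_iff topspace_eq intro: openin_mono)

lemma regular_opens_iff:
  "b \<in> regular_opens X \<longleftrightarrow>
    openin X b \<and> (\<forall>p\<in>P. (\<forall>q\<in>P. q \<unlhd> p \<longrightarrow> (\<exists>r\<in>P. r \<unlhd> q \<and> r \<in> b)) \<longrightarrow> p \<in> b)"
proof -
  have "b \<subseteq> X interior_of (X closure_of b)" if "openin X b"
    using that by (simp add: interior_of_maximal closure_of_subset openin_subset)
  moreover have "X interior_of (X closure_of b) =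
      {p \<in> P. \<forall>q\<in>P. q \<unlhd> p \<longrightarrow> (\<exists>r\<in>P. r \<unlhd> q \<and> r \<in> b)}"
    by (auto simp: in_interior_iff in_closure_iff)
  ultimately show ?thesis
    unfolding regular_opens_def by auto
qed

text \<open>
  The main tool below: a regular open set contains every condition below which it is dense.
\<close>

lemma regular_openI:
  assumes "b \<in> regular_opens X" "p \<in> P"
    and "\<And>q. q \<in> P \<Longrightarrow> q \<unlhd> p \<Longrightarrow> \<exists>r\<in>P. r \<unlhd> q \<and> r \<in> b"
  shows "p \<in> b"
  using assms by (auto simp: regular_opens_iff)

lemma regular_open_openin: "b \<in> regular_opens X \<Longrightarrow> openin X b"
  by (simp add: regular_opens_def)

lemma interior_closure_regular: "X interior_of (X closure_of S) \<in> regular_opens X"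
proof -
  have "p \<in> X interior_of (X closure_of S)"
    if p: "p \<in> P" and *: "\<And>q. q \<in> P \<Longrightarrow> q \<unlhd> p \<Longrightarrow> \<exists>r\<in>P. r \<unlhd> q \<and> r \<in> X interior_of (X closure_of S)" for p
    unfolding in_interior_iff in_closure_iff
  proof (intro conjI ballI impI p)
    fix q assume q: "q \<in> P" "q \<unlhd> p"
    then obtain r where r: "r \<in> P" "r \<unlhd> q" "r \<in> X interior_of (X closure_of S)"
      using * by blast
    then obtain s where "s \<in> P" "s \<unlhd> r" "s \<in> S"
      using ext_refl unfolding in_interior_iff in_closure_iff by blast
    then show "\<exists>s\<in>P. s \<unlhd> q \<and> s \<in> S"
      using r ext_trans by blast
    show "q \<in> P"
      by (rule q)
  qed
  then show ?thesis
    unfolding regular_opens_iff by simp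
qed

lemma ro_Sup_regular: "ro_Sup X A \<in> regular_opens X"
  unfolding ro_Sup_def by (rule interior_closure_regular)

lemma ro_neg_regular: "openin X b \<Longrightarrow> ro_neg X b \<in> regular_opens X"
  unfolding regular_opens_iff
proof (intro conjI ballI impI)
  show "openin X (ro_neg X b)"
    by (simp add: ro_neg_def)
  fix p assume b: "openin X b" and p: "p \<in> P"
    and *: "\<forall>q\<in>P. q \<unlhd> p \<longrightarrow> (\<exists>r\<in>P. r \<unlhd> q \<and> r \<in> ro_neg X b)"
  then show "p \<in> ro_neg X b"
    unfolding in_ro_neg_iff using openin_mono[OF b] ext_refl by blast
qed

lemma regular_open_Int:
  "a \<in> regular_opens X \<Longrightarrow> b \<in> regular_opens X \<Longrightarrow> a \<inter> b \<in> regular_opens X"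
  unfolding regular_opens_iff Int_iff by (meson openin_Int)

lemma in_implication_iff:
  assumes "openin X a" "b \<in> regular_opens X"
  shows "p \<in> ro_join X (ro_neg X a) b \<longleftrightarrow> p \<in> P \<and> (\<forall>q\<in>P. q \<unlhd> p \<longrightarrow> q \<in> a \<longrightarrow> q \<in> b)"
proof (intro iffI conjI ballI impI)
  assume p: "p \<in> ro_join X (ro_neg X a) b"
  then show "p \<in> P"
    by (simp add: ro_join_def in_ro_Sup_iff)
  fix q assume q: "q \<in> P" "q \<unlhd> p" "q \<in> a"
  show "q \<in> b"
  proof (rule regular_openI[OF assms(2) q(1)])
    fix r assume r: "r \<in> P" "r \<unlhd> q"
    then obtain s where "s \<in> P" "s \<unlhd> r" "s \<in> ro_neg X a \<or> s \<in> b"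
      using p q(2) by (auto simp: ro_join_def in_ro_Sup_iff dest: ext_trans)
    moreover have "s \<in> a"
      using assms(1) q r calculation by (meson ext_trans openin_mono)
    ultimately show "\<exists>r'\<in>P. r' \<unlhd> r \<and> r' \<in> b"
      by (auto simp: in_ro_neg_iff)
  qed
next
  assume p: "p \<in> P \<and> (\<forall>q\<in>P. q \<unlhd> p \<longrightarrow> q \<in> a \<longrightarrow> q \<in> b)"
  show "p \<in> ro_join X (ro_neg X a) b"
    unfolding ro_join_def in_ro_Sup_iff
  proof (intro conjI ballI impI)
    fix q assume q: "q \<in> P" "q \<unlhd> p"
    show "\<exists>r\<in>P. r \<unlhd> q \<and> r \<in> \<Union> {ro_neg X a, b}"
    proof (cases "q \<in> ro_neg X a")
      case False
      then obtain r where "r \<in> P" "r \<unlhd> q" "r \<in> a"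
        using q by (auto simp: in_ro_neg_iff)
      then show ?thesis
        using p q by (meson ext_trans UnionI insertCI)
    qed (use q ext_refl in blast)
  qed (use p in simp)
qed

lemma bval_mem_regular: "bval_mem X \<tau> \<sigma> \<in> regular_opens X"
  by (subst bval_mem.simps) (rule ro_Sup_regular)

text \<open>
  The forcing clauses for membership and inclusion. They are applied one step at a time: each mentions
  the other, so together they do not terminate as rewrite rules.
\<close>

lemma in_bval_mem_iff:
  "p \<in> bval_mem X \<tau> \<sigma> \<longleftrightarrow> p \<in> P \<and> (\<forall>q\<in>P. q \<unlhd> p \<longrightarrow>
    (\<exists>r\<in>P. r \<unlhd> q \<and> (\<exists>\<eta> b. vpair \<eta> b \<in> elts \<sigma> \<and> r \<in> bval_eq X \<tau> \<eta> \<and> r \<in> elts b)))"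
  by (subst bval_mem.simps) (fastforce simp: in_ro_Sup_iff)

lemma in_bval_sub_iff:
  "p \<in> bval_sub X \<tau> \<sigma> \<longleftrightarrow> p \<in> P \<and> (\<forall>\<eta>\<in>name_dom \<tau>. \<forall>q\<in>P. q \<unlhd> p \<longrightarrow>
    q \<in> bval_mem X \<eta> \<tau> \<longrightarrow> q \<in> bval_mem X \<eta> \<sigma>)"
proof -
  have "openin X (ro_join X (ro_neg X (bval_mem X \<eta> \<tau>)) (bval_mem X \<eta> \<sigma>))" for \<eta>
    unfolding ro_join_def using ro_Sup_regular regular_open_openin by blast
  then have "p \<in> bval_sub X \<tau> \<sigma> \<longleftrightarrow> p \<in> P \<and> (\<forall>\<eta>\<in>name_dom \<tau>.
      p \<in> ro_join X (ro_neg X (bval_mem X \<eta> \<tau>)) (bval_mem X \<eta> \<sigma>))"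
    by (subst bval_sub.simps, subst in_ro_Inf_iff) auto
  then show ?thesis
    by (auto simp: in_implication_iff bval_mem_regular regular_open_openin)
qed

lemma in_bval_eq_iff: "p \<in> bval_eq X \<tau> \<sigma> \<longleftrightarrow> p \<in> bval_sub X \<tau> \<sigma> \<and> p \<in> bval_sub X \<sigma> \<tau>"
  by (subst bval_eq.simps) simp

lemma bval_sub_regular: "bval_sub X \<tau> \<sigma> \<in> regular_opens X"
  unfolding regular_opens_iff openin_iff
proof (intro conjI ballI[where A=P] impI)
  fix p assume p: "p \<in> P" and *: "\<forall>q\<in>P. q \<unlhd> p \<longrightarrow> (\<exists>r\<in>P. r \<unlhd> q \<and> r \<in> bval_sub X \<tau> \<sigma>)"
  show "p \<in> bval_sub X \<tau> \<sigma>"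
    unfolding in_bval_sub_iff
  proof (intro conjI ballI impI p)
    fix \<eta> q assume \<eta>: "\<eta> \<in> name_dom \<tau>" and q: "q \<in> P" "q \<unlhd> p" "q \<in> bval_mem X \<eta> \<tau>"
    show "q \<in> bval_mem X \<eta> \<sigma>"
    proof (rule regular_openI[OF bval_mem_regular q(1)])
      fix r assume r: "r \<in> P" "r \<unlhd> q"
      then obtain s where s: "s \<in> P" "s \<unlhd> r" "s \<in> bval_sub X \<tau> \<sigma>"
        using * q by (meson ext_trans)
      moreover have "s \<in> bval_mem X \<eta> \<tau>"
        using q r s by (meson bval_mem_regular regular_open_openin openin_mono ext_trans)
      ultimately show "\<exists>s\<in>P. s \<unlhd> r \<and> s \<in> bval_mem X \<eta> \<sigma>"
        using \<eta> by (auto simp: in_bval_sub_iff)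
    qed
  qed
next
  show "bval_sub X \<tau> \<sigma> \<subseteq> P"
    by (simp add: in_bval_sub_iff subset_eq)
  show "\<forall>p\<in>bval_sub X \<tau> \<sigma>. \<forall>q\<in>P. q \<unlhd> p \<longrightarrow> q \<in> bval_sub X \<tau> \<sigma>"
    by (intro ballI impI, unfold in_bval_sub_iff) (blast intro: ext_trans)
qed

lemma bval_eq_regular: "bval_eq X \<tau> \<sigma> \<in> regular_opens X"
  by (subst bval_eq.simps) (intro regular_open_Int bval_sub_regular)

lemma bval_ground_regular: "bval_ground X \<tau> \<in> regular_opens X"
  unfolding bval_ground_def by (rule ro_Sup_regular)

lemmas bval_openin =
  bval_mem_regular[THEN regular_open_openin]
  bval_sub_regular[THEN regular_open_openin]
  bval_eq_regular[THEN regular_open_openin]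

lemmas bval_mono = bval_openin[THEN openin_mono]

lemma bval_in_P:
  "p \<in> bval_mem X \<tau> \<sigma> \<Longrightarrow> p \<in> P" "p \<in> bval_eq X \<tau> \<sigma> \<Longrightarrow> p \<in> P"
  using bval_openin unfolding openin_iff by blast+

subsection \<open>Equality axioms\<close>

text \<open>
  No induction is needed, because inclusion is defined through the truth value of membership rather than
  through the values that occur in the name.
\<close>

lemma bval_eq_refl: "p \<in> P \<Longrightarrow> p \<in> bval_eq X \<tau> \<tau>"
  by (simp add: in_bval_eq_iff in_bval_sub_iff)

lemma bval_eq_sym: "p \<in> bval_eq X \<tau> \<sigma> \<Longrightarrow> p \<in> bval_eq X \<sigma> \<tau>"
  by (simp add: in_bval_eq_iff)

lemma is_name_pairD:
  assumes "is_name X \<tau>" "vpair \<eta> b \<in> elts \<tau>"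
  shows "is_name X \<eta>" "elts b \<in> regular_opens X"
  using assms(1)[THEN is_name.cases] assms(2) by (metis vpair_inject)+

lemma is_name_dom: "is_name X \<tau> \<Longrightarrow> \<eta> \<in> name_dom \<tau> \<Longrightarrow> is_name X \<eta>"
  by (auto simp: name_dom_def dest: is_name_pairD)

lemma bval_mem_pair:
  assumes "is_name X \<tau>" "vpair \<eta> b \<in> elts \<tau>" "p \<in> elts b"
  shows "p \<in> bval_mem X \<eta> \<tau>"
proof -
  have b: "openin X (elts b)"
    using assms(1,2) is_name_pairD regular_open_openin by blast
  then show ?thesis
    unfolding in_bval_mem_iff using assms b
    by (meson bval_eq_refl ext_refl openin_iff openin_mono subsetD)
qed

text \<open>
  Below a condition forcing \<open>\<eta> \<in> \<sigma>\<close> and \<open>\<sigma> \<subseteq> \<rho>\<close> there is one that witnesses both memberships, with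
  elements of the domains of \<open>\<sigma>\<close> and \<open>\<rho>\<close> as intermediate names.
\<close>

lemma bval_mem_subD:
  assumes "is_name X \<sigma>" "p \<in> bval_mem X \<eta> \<sigma>" "p \<in> bval_sub X \<sigma> \<rho>"
  obtains q \<zeta> \<theta> b where "q \<in> P" "q \<unlhd> p" "\<zeta> \<in> name_dom \<sigma>" "vpair \<theta> b \<in> elts \<rho>" "q \<in> elts b"
    "q \<in> bval_eq X \<eta> \<zeta>" "q \<in> bval_eq X \<zeta> \<theta>"
proof -
  have p: "p \<in> P"
    using assms(2) bval_in_P by blast
  obtain r \<zeta> c where r: "r \<in> P" "r \<unlhd> p" "vpair \<zeta> c \<in> elts \<sigma>" "r \<in> bval_eq X \<eta> \<zeta>" "r \<in> elts c"
    using assms(2) p ext_refl unfolding in_bval_mem_iff by meson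
  have \<zeta>: "\<zeta> \<in> name_dom \<sigma>"
    using r by (auto simp: name_dom_def)
  have "r \<in> bval_mem X \<zeta> \<rho>"
    using assms r \<zeta> by (auto simp: in_bval_sub_iff dest: bval_mem_pair)
  then obtain q \<theta> b where q: "q \<in> P" "q \<unlhd> r" "vpair \<theta> b \<in> elts \<rho>" "q \<in> bval_eq X \<zeta> \<theta>" "q \<in> elts b"
    using r ext_refl unfolding in_bval_mem_iff by meson
  then show thesis
    using that[of q \<zeta> \<theta> b] r \<zeta> by (meson bval_mono ext_trans)
qed

text \<open>
  The inductive step for transitivity of equality. Inclusion is transitive because equality is
  transitive for the names in the three domains, which have smaller rank. Both inclusions of the
  induction are instances, one of them with the roles of the outer names exchanged.
\<close>

lemma bval_sub_trans_step:
  assumes names: "is_name X \<sigma>" "is_name X \<rho>"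
    and sub: "p \<in> bval_sub X \<tau> \<sigma>" "p \<in> bval_sub X \<sigma> \<rho>"
    and IH: "\<And>\<eta> \<zeta> \<theta> q. \<eta> \<in> name_dom \<tau> \<Longrightarrow> \<zeta> \<in> name_dom \<sigma> \<Longrightarrow> \<theta> \<in> name_dom \<rho> \<Longrightarrow>
      q \<in> bval_eq X \<eta> \<zeta> \<Longrightarrow> q \<in> bval_eq X \<zeta> \<theta> \<Longrightarrow> q \<in> bval_eq X \<eta> \<theta>"
  shows "p \<in> bval_sub X \<tau> \<rho>"
  unfolding in_bval_sub_iff
proof (intro conjI ballI impI)
  show "p \<in> P"
    using sub(1) by (simp add: in_bval_sub_iff)
  fix \<eta> q assume \<eta>: "\<eta> \<in> name_dom \<tau>" and q: "q \<in> P" "q \<unlhd> p" "q \<in> bval_mem X \<eta> \<tau>"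
  show "q \<in> bval_mem X \<eta> \<rho>"
  proof (rule regular_openI[OF bval_mem_regular q(1)])
    fix r assume r: "r \<in> P" "r \<unlhd> q"
    have "q \<in> bval_mem X \<eta> \<sigma>"
      using sub(1) q \<eta> by (simp add: in_bval_sub_iff)
    then have "r \<in> bval_mem X \<eta> \<sigma>"
      using bval_mono(1) r by blast
    moreover have "r \<in> bval_sub X \<sigma> \<rho>"
      using bval_mono(2)[OF sub(2)] q r ext_trans by blast
    ultimately obtain s \<zeta> \<theta> b where s: "s \<in> P" "s \<unlhd> r" "\<zeta> \<in> name_dom \<sigma>"
      "vpair \<theta> b \<in> elts \<rho>" "s \<in> elts b" "s \<in> bval_eq X \<eta> \<zeta>" "s \<in> bval_eq X \<zeta> \<theta>"
      using bval_mem_subD[OF names(1)] by blast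
    have \<theta>: "\<theta> \<in> name_dom \<rho>"
      using s(4) by (auto simp: name_dom_def)
    have "s \<in> bval_mem X \<theta> \<rho>"
      using bval_mem_pair names(2) s by blast
    moreover have "s \<in> bval_eq X \<eta> \<theta>"
      using IH[OF \<eta> s(3) \<theta>] s by blast
    ultimately have "s \<in> bval_mem X \<eta> \<rho>"
      unfolding in_bval_mem_iff using s(1,4,5) is_name_pairD(2)[OF names(2) s(4)]
        regular_open_openin openin_mono bval_mono(3) by (meson ext_refl)
    then show "\<exists>r'\<in>P. r' \<unlhd> r \<and> r' \<in> bval_mem X \<eta> \<rho>"
      using s by blast
  qed
qed

lemma bval_eq_trans:
  assumes "is_name X \<tau>" "is_name X \<sigma>" "is_name X \<rho>"
    and "p \<in> bval_eq X \<tau> \<sigma>" "p \<in> bval_eq X \<sigma> \<rho>"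
  shows "p \<in> bval_eq X \<tau> \<rho>"
  using assms
proof (induction \<tau> arbitrary: \<sigma> \<rho> p rule: wf_induct_rule[OF wf_trancl[OF foundation]])
  case (1 \<tau>)
  note names = 1(2-4)
  have IH: "q \<in> bval_eq X \<eta> \<theta>"
    if "\<eta> \<in> name_dom \<tau>" "\<zeta> \<in> name_dom \<sigma>" "\<theta> \<in> name_dom \<rho>"
      "q \<in> bval_eq X \<eta> \<zeta>" "q \<in> bval_eq X \<zeta> \<theta>" for \<eta> \<zeta> \<theta> q
  proof (rule 1(1)[of \<eta> \<zeta> \<theta> q])
    show "(\<eta>, \<tau>) \<in> mem_rel\<^sup>+"
      using that(1) unfolding name_dom_def by (auto intro: vpair_mem_imp_trancl)
  qed (use that names is_name_dom in blast)+
  have sub: "p \<in> bval_sub X \<tau> \<sigma>" "p \<in> bval_sub X \<sigma> \<tau>" "p \<in> bval_sub X \<sigma> \<rho>" "p \<in> bval_sub X \<rho> \<sigma>"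
    using 1(5,6) by (simp_all add: in_bval_eq_iff)
  have "p \<in> bval_sub X \<tau> \<rho>"
    by (rule bval_sub_trans_step[OF names(2,3) sub(1,3)]) (rule IH)
  moreover have "p \<in> bval_sub X \<rho> \<tau>"
    by (rule bval_sub_trans_step[OF names(2,1) sub(4,2)]) (meson IH bval_eq_sym)
  ultimately show ?case
    by (simp add: in_bval_eq_iff)
qed

lemma bval_mem_cong_left:
  assumes "is_name X \<tau>" "is_name X \<sigma>" "is_name X \<rho>"
    and "p \<in> bval_eq X \<tau> \<sigma>" "p \<in> bval_mem X \<tau> \<rho>"
  shows "p \<in> bval_mem X \<sigma> \<rho>"
  unfolding in_bval_mem_iff
proof (intro conjI ballI impI)
  show "p \<in> P"
    using assms(4) bval_in_P by blast
  fix q assume q: "q \<in> P" "q \<unlhd> p"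
  obtain r \<eta> b where r: "r \<in> P" "r \<unlhd> q" "vpair \<eta> b \<in> elts \<rho>" "r \<in> bval_eq X \<tau> \<eta>" "r \<in> elts b"
    using assms(5) q unfolding in_bval_mem_iff by blast
  have "r \<in> bval_eq X \<sigma> \<tau>"
    using assms(4) q r by (meson bval_eq_sym bval_mono ext_trans)
  then have "r \<in> bval_eq X \<sigma> \<eta>"
    using r assms bval_eq_trans is_name_pairD(1) by blast
  then show "\<exists>r\<in>P. r \<unlhd> q \<and> (\<exists>\<eta> b. vpair \<eta> b \<in> elts \<rho> \<and> r \<in> bval_eq X \<sigma> \<eta> \<and> r \<in> elts b)"
    using r by blast
qed

text \<open>
  A witness \<open>\<eta>\<close> from the domain of \<open>\<sigma>\<close> is moved into \<open>\<rho>\<close> by \<open>\<sigma> \<subseteq> \<rho>\<close> and then replaced by \<open>\<tau>\<close>, using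
  the other congruence.
\<close>

lemma bval_mem_cong_right:
  assumes "is_name X \<tau>" "is_name X \<sigma>" "is_name X \<rho>"
    and "p \<in> bval_eq X \<sigma> \<rho>" "p \<in> bval_mem X \<tau> \<sigma>"
  shows "p \<in> bval_mem X \<tau> \<rho>"
proof (rule regular_openI[OF bval_mem_regular])
  show "p \<in> P"
    using assms(4) bval_in_P by blast
  fix q assume q: "q \<in> P" "q \<unlhd> p"
  obtain r \<eta> b where r: "r \<in> P" "r \<unlhd> q" "vpair \<eta> b \<in> elts \<sigma>" "r \<in> bval_eq X \<tau> \<eta>" "r \<in> elts b"
    using assms(5) q unfolding in_bval_mem_iff by blast
  have "r \<in> bval_mem X \<eta> \<sigma>"
    using assms(2) r bval_mem_pair by blast
  moreover have "r \<in> bval_sub X \<sigma> \<rho>"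
    using assms(4) q r by (meson in_bval_eq_iff bval_mono ext_trans)
  ultimately have "r \<in> bval_mem X \<eta> \<rho>"
    using r by (auto simp: in_bval_sub_iff name_dom_def)
  then have "r \<in> bval_mem X \<tau> \<rho>"
    using r assms bval_mem_cong_left bval_eq_sym is_name_pairD(1) by blast
  then show "\<exists>r\<in>P. r \<unlhd> q \<and> r \<in> bval_mem X \<tau> \<rho>"
    using r by blast
qed

subsection \<open>Names for ground-model sets\<close>

lemma vpair_in_check_name:
  "vpair \<eta> b \<in> elts (check_name X x) \<longleftrightarrow> b = vset P \<and> (\<exists>y \<in> elts x. \<eta> = check_name X y)"
  by (subst check_name.simps) (auto simp: small_image topspace_eq)

lemma name_dom_check_name: "name_dom (check_name X x) = check_name X ` elts x"
  by (auto simp: name_dom_def vpair_in_check_name)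

lemma is_name_check_name: "is_name X (check_name X x)"
proof (induction x rule: wf_induct_rule[OF foundation])
  case (1 x)
  have "P \<in> regular_opens X"
    by (auto simp: regular_opens_iff openin_iff)
  then show ?case
    using 1 by (subst check_name.simps, intro is_name.intros)
      (auto simp: small_image topspace_eq small_P)
qed

lemma in_bval_mem_check_iff:
  "p \<in> bval_mem X \<tau> (check_name X x) \<longleftrightarrow> p \<in> P \<and> (\<forall>q\<in>P. q \<unlhd> p \<longrightarrow>
    (\<exists>r\<in>P. r \<unlhd> q \<and> (\<exists>y\<in>elts x. r \<in> bval_eq X \<tau> (check_name X y))))"
  unfolding in_bval_mem_iff vpair_in_check_name using small_P by fastforce

text \<open>
  Equality between ground-model sets is absolute: a single condition forcing it suffices. By induction,
  since forced membership in \<open>y\<close> provides an element of \<open>y\<close> that some extension forces to be equal.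
\<close>

lemma bval_eq_check_imp_eq: "p \<in> bval_eq X (check_name X x) (check_name X y) \<Longrightarrow> x = y"
proof (induction x arbitrary: y p rule: wf_induct_rule[OF foundation])
  case (1 x)
  have p: "p \<in> P"
    using 1(2) bval_in_P by blast
  have sub: "p \<in> bval_sub X (check_name X x) (check_name X y)"
    "p \<in> bval_sub X (check_name X y) (check_name X x)"
    using 1(2) by (auto simp: in_bval_eq_iff)
  have self: "p \<in> bval_mem X (check_name X u) (check_name X z)" if "u \<in> elts z" for u z
    unfolding in_bval_mem_check_iff using that p bval_eq_refl ext_refl by blast
  show ?case
  proof (intro extensionality set_eqI iffI)
    fix u assume u: "u \<in> elts x"
    then have "p \<in> bval_mem X (check_name X u) (check_name X y)"
      using sub(1) self p ext_refl by (auto simp: in_bval_sub_iff name_dom_check_name)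
    then obtain r v where "v \<in> elts y" "r \<in> bval_eq X (check_name X u) (check_name X v)"
      using p ext_refl unfolding in_bval_mem_check_iff by meson
    then show "u \<in> elts y"
      using 1(1)[of u r v] u by auto
  next
    fix v assume v: "v \<in> elts y"
    then have "p \<in> bval_mem X (check_name X v) (check_name X x)"
      using sub(2) self p ext_refl by (auto simp: in_bval_sub_iff name_dom_check_name)
    then obtain r u where "u \<in> elts x" "r \<in> bval_eq X (check_name X v) (check_name X u)"
      using p ext_refl unfolding in_bval_mem_check_iff by meson
    then show "v \<in> elts x"
      using 1(1)[of u r v] bval_eq_sym by auto
  qed
qed

lemma bval_mem_check_iff:
  assumes "p \<in> P"
  shows "p \<in> bval_mem X (check_name X x) (check_name X y) \<longleftrightarrow> x \<in> elts y"
  unfolding in_bval_mem_check_iff using assms bval_eq_check_imp_eq bval_eq_refl ext_refl by metis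

lemma bval_eq_subset_ground: "bval_eq X \<tau> (check_name X x) \<subseteq> bval_ground X \<tau>"
proof
  fix p assume p: "p \<in> bval_eq X \<tau> (check_name X x)"
  then have "p \<in> P" "\<And>q. q \<in> P \<Longrightarrow> q \<unlhd> p \<Longrightarrow> q \<in> bval_eq X \<tau> (check_name X x)"
    by (auto intro: bval_in_P bval_mono)
  then show "p \<in> bval_ground X \<tau>"
    unfolding bval_ground_def in_ro_Sup_iff by (auto intro!: bexI[OF _ ] ext_refl)
qed

subsection \<open>Mixing\<close>

text \<open>
  The name contains the ground-model element \<open>y\<close> with value \<open>b i\<close> whenever \<open>y \<in> f i\<close>. Below \<open>b i\<close> only the
  pairs with index \<open>i\<close> matter, by disjointness, so there the name has the same elements as \<open>f i\<close>.
\<close>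

lemma mixing_exists:
  fixes I :: "'v set"
  assumes I: "small I"
    and b: "\<And>i. i \<in> I \<Longrightarrow> b i \<in> regular_opens X"
    and disj: "\<And>i j. i \<in> I \<Longrightarrow> j \<in> I \<Longrightarrow> i \<noteq> j \<Longrightarrow> b i \<inter> b j = {}"
  obtains \<tau> where "is_name X \<tau>"
    and "\<And>i. i \<in> I \<Longrightarrow> b i \<subseteq> bval_eq X \<tau> (check_name X (f i))"
proof -
  have b_small: "small (b i)" "b i \<subseteq> P" if "i \<in> I" for i
    using b[OF that] small_P small_subset by (auto simp: regular_opens_iff openin_iff)
  define \<tau> where "\<tau> = vset (\<Union>i\<in>I. (\<lambda>y. vpair (check_name X y) (vset (b i))) ` elts (f i))"
  have elts_\<tau>: "elts \<tau> = (\<Union>i\<in>I. (\<lambda>y. vpair (check_name X y) (vset (b i))) ` elts (f i))"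
    unfolding \<tau>_def by (intro elts_vset small_UN I small_image small_elts)
  have "is_name X \<tau>"
    by (rule is_name.intros) (auto simp: elts_\<tau> is_name_check_name b b_small)
  moreover have "b i \<subseteq> bval_eq X \<tau> (check_name X (f i))" if i: "i \<in> I" for i
  proof
    fix p assume p: "p \<in> b i"
    then have "p \<in> P"
      using b_small i by blast
    have below: "q \<in> b i" if "q \<in> P" "q \<unlhd> p" for q
      using that p b[OF i] regular_open_openin openin_mono by blast
    have "p \<in> bval_sub X \<tau> (check_name X (f i))"
      unfolding in_bval_sub_iff
    proof (intro conjI ballI impI \<open>p \<in> P\<close>)
      fix \<eta> q assume \<eta>: "\<eta> \<in> name_dom \<tau>" and q: "q \<in> P" "q \<unlhd> p" "q \<in> bval_mem X \<eta> \<tau>"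
      show "q \<in> bval_mem X \<eta> (check_name X (f i))"
        unfolding in_bval_mem_check_iff
      proof (intro conjI ballI impI q)
        fix r assume r: "r \<in> P" "r \<unlhd> q"
        then obtain s \<zeta> c where s: "s \<in> P" "s \<unlhd> r" "vpair \<zeta> c \<in> elts \<tau>" "s \<in> bval_eq X \<eta> \<zeta>" "s \<in> elts c"
          using q unfolding in_bval_mem_iff by blast
        then obtain j y where j: "j \<in> I" "y \<in> elts (f j)" "\<zeta> = check_name X y" "c = vset (b j)"
          by (auto simp: elts_\<tau>)
        have "s \<in> b i"
          using below s q r ext_trans by blast
        moreover have "s \<in> b j"
          using s j b_small by simp
        ultimately have "j = i"
          using disj[OF j(1) i] by blast
        then show "\<exists>s\<in>P. s \<unlhd> r \<and> (\<exists>y\<in>elts (f i). s \<in> bval_eq X \<eta> (check_name X y))"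
          using s j by blast
      qed
    qed
    moreover have "p \<in> bval_sub X (check_name X (f i)) \<tau>"
      unfolding in_bval_sub_iff name_dom_check_name
    proof (intro conjI ballI impI \<open>p \<in> P\<close>)
      fix \<eta> q assume \<eta>: "\<eta> \<in> check_name X ` elts (f i)" and q: "q \<in> P" "q \<unlhd> p"
      then have "vpair \<eta> (vset (b i)) \<in> elts \<tau>"
        using i by (auto simp: elts_\<tau>)
      then show "q \<in> bval_mem X \<eta> \<tau>"
        using \<open>is_name X \<tau>\<close> below[OF q] b_small i bval_mem_pair by simp
    qed
    ultimately show "p \<in> bval_eq X \<tau> (check_name X (f i))"
      by (simp add: in_bval_eq_iff)
  qed
  ultimately show thesis
    by (rule that)
qed

lemma ro_Sup_disjoint:
  assumes "openin X a" "openin X b" "a \<inter> b = {}"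
  shows "ro_Sup X {a} \<inter> ro_Sup X {b} = {}"
proof (intro equals0I)
  fix p assume p: "p \<in> ro_Sup X {a} \<inter> ro_Sup X {b}"
  then obtain q where q: "q \<in> P" "q \<unlhd> p" "q \<in> a"
    by (auto simp: in_ro_Sup_iff dest: bspec[OF _ _, of P _ p])
  then obtain r where "r \<in> P" "r \<unlhd> q" "r \<in> b"
    using p by (auto simp: in_ro_Sup_iff)
  then show False
    using assms q openin_mono by blast
qed

end

section \<open>Collapses of corresponding quotients\<close>

text \<open>
  The values of \<open>collapse\<close> at two points with the same image of predecessors agree even if that image is
  a proper class, so isomorphic relations can be compared without showing that they are set-like.
\<close>

lemma collapse_unfold:
  assumes "wf E"
  shows "collapse E x = vset (collapse E ` {y. (y, x) \<in> E})"
proof -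
  have "collapse E x = vset (cut (collapse E) E x ` {y. (y, x) \<in> E})"
    unfolding collapse_def by (subst wfrec[OF assms]) simp
  also have "cut (collapse E) E x ` {y. (y, x) \<in> E} = collapse E ` {y. (y, x) \<in> E}"
    by (intro image_cong) (auto simp: cut_apply)
  finally show ?thesis .
qed

text \<open>
  An isomorphism of quotients, given by a relation \<open>R\<close> between representatives. The relation is total on
  both sides, and only the second structure is assumed to be well-founded with equivalence classes
  governed by \<open>eq2\<close>; both properties are transported to the first.
\<close>

lemma quotient_correspondence:
  assumes eq: "\<And>x y u v. x \<in> D1 \<Longrightarrow> y \<in> D1 \<Longrightarrow> u \<in> D2 \<Longrightarrow> v \<in> D2 \<Longrightarrow> R x u \<Longrightarrow> R y v \<Longrightarrow>
      eq1 x y \<longleftrightarrow> eq2 u v"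
    and mem: "\<And>x y u v. x \<in> D1 \<Longrightarrow> y \<in> D1 \<Longrightarrow> u \<in> D2 \<Longrightarrow> v \<in> D2 \<Longrightarrow> R x u \<Longrightarrow> R y v \<Longrightarrow>
      mem1 x y \<longleftrightarrow> mem2 u v"
    and tot1: "\<And>x. x \<in> D1 \<Longrightarrow> \<exists>u\<in>D2. R x u"
    and tot2: "\<And>u. u \<in> D2 \<Longrightarrow> \<exists>x\<in>D1. R x u"
    and class2: "\<And>u v. u \<in> D2 \<Longrightarrow> v \<in> D2 \<Longrightarrow>
      quot_class D2 eq2 u = quot_class D2 eq2 v \<longleftrightarrow> eq2 u v"
    and wf2: "wf (quot_mem D2 eq2 mem2)"
  shows "wf (quot_mem D1 eq1 mem1)"
    and "x \<in> D1 \<Longrightarrow> u \<in> D2 \<Longrightarrow> R x u \<Longrightarrow>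
      (collapse (quot_mem D1 eq1 mem1) (quot_class D1 eq1 x) :: 'v::zfc_universe) =
      collapse (quot_mem D2 eq2 mem2) (quot_class D2 eq2 u)"
proof -
  let ?c1 = "quot_class D1 eq1" and ?c2 = "quot_class D2 eq2"
  let ?E1 = "quot_mem D1 eq1 mem1" and ?E2 = "quot_mem D2 eq2 mem2"
  have class1: "?c1 x = ?c1 y \<longleftrightarrow> eq1 x y" if "x \<in> D1" "y \<in> D1" for x y
  proof -
    have eq1: "eq1 x y \<longleftrightarrow> ?c2 u = ?c2 v"
      if "x \<in> D1" "y \<in> D1" "u \<in> D2" "v \<in> D2" "R x u" "R y v" for x y u v
      using eq[OF that] class2 that by blast
    obtain u where u: "u \<in> D2" "R x u"
      using tot1 \<open>x \<in> D1\<close> by blast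
    obtain v where v: "v \<in> D2" "R y v"
      using tot1 \<open>y \<in> D1\<close> by blast
    have "eq1 y y"
      using eq1[of y y v v] that v by blast
    moreover have "eq1 x z \<longleftrightarrow> eq1 y z" if xy: "eq1 x y" and z: "z \<in> D1" for z
    proof -
      obtain w where "w \<in> D2" "R z w"
        using tot1 z by blast
      then show ?thesis
        using eq1[of x z u w] eq1[of y z v w] eq1[of x y u v] \<open>x \<in> D1\<close> \<open>y \<in> D1\<close> u v xy z by simp
    qed
    ultimately show ?thesis
      using that unfolding quot_class_def by blast
  qed
  have class12: "?c1 x = ?c1 y \<longleftrightarrow> ?c2 u = ?c2 v"
    if "x \<in> D1" "y \<in> D1" "u \<in> D2" "v \<in> D2" "R x u" "R y v" for x y u v
    using eq[OF that] class1 class2 that by blast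
  define h where "h c = ?c2 (SOME u. u \<in> D2 \<and> (\<exists>x\<in>D1. c = ?c1 x \<and> R x u))" for c
  have h: "h (?c1 x) = ?c2 u" if "x \<in> D1" "u \<in> D2" "R x u" for x u
  proof -
    have "\<exists>u. u \<in> D2 \<and> (\<exists>y\<in>D1. ?c1 x = ?c1 y \<and> R y u)"
      using that by blast
    from someI_ex[OF this] show ?thesis
      unfolding h_def using class12[OF that(1) _ that(2) _ that(3)] by blast
  qed
  have "?E1 \<subseteq> inv_image ?E2 h"
  proof clarify
    fix a b assume "(a, b) \<in> ?E1"
    then obtain x y where xy: "x \<in> D1" "y \<in> D1" "a = ?c1 x" "b = ?c1 y" "mem1 x y"
      unfolding quot_mem_def by blast
    obtain u v where uv: "u \<in> D2" "R x u" "v \<in> D2" "R y v"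
      using tot1 xy by meson
    then have "mem2 u v"
      using mem xy by blast
    then have "(?c2 u, ?c2 v) \<in> ?E2"
      unfolding quot_mem_def using uv by blast
    then show "(a, b) \<in> inv_image ?E2 h"
      using h xy uv by simp
  qed
  then show wf1: "wf ?E1"
    using wf_inv_image[OF wf2] wf_subset by blast
  have step: "collapse ?E1 (?c1 x) = (collapse ?E2 b :: 'v)"
    if "x \<in> D1" "u \<in> D2" "R x u" "b = ?c2 u" for x u b
    using that
  proof (induction b arbitrary: x u rule: wf_induct_rule[OF wf2])
    case (1 b)
    have "collapse ?E1 ` {a. (a, ?c1 x) \<in> ?E1} = (collapse ?E2 ` {c. (c, b) \<in> ?E2} :: 'v set)"
    proof (intro equalityI subsetI)
      fix z :: 'v assume "z \<in> collapse ?E1 ` {a. (a, ?c1 x) \<in> ?E1}"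
      then obtain x' y' where x': "x' \<in> D1" "y' \<in> D1" "mem1 x' y'" "?c1 y' = ?c1 x"
        "z = collapse ?E1 (?c1 x')"
        unfolding quot_mem_def by auto
      obtain u' v' where u': "u' \<in> D2" "R x' u'" "v' \<in> D2" "R y' v'"
        using tot1 x' by meson
      have "?c2 v' = b" "mem2 u' v'"
        using class12[of y' x v' u] mem[of x' y' u' v'] x' u' 1(2-5) by auto
      then have "(?c2 u', b) \<in> ?E2"
        unfolding quot_mem_def using u' by blast
      moreover from this have "z = collapse ?E2 (?c2 u')"
        using 1(1)[of "?c2 u'" x' u'] x' u' by simp
      ultimately show "z \<in> collapse ?E2 ` {c. (c, b) \<in> ?E2}"
        by blast
    next
      fix z :: 'v assume "z \<in> collapse ?E2 ` {c. (c, b) \<in> ?E2}"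
      then obtain u' v' where u': "u' \<in> D2" "v' \<in> D2" "mem2 u' v'" "?c2 v' = b"
        "z = collapse ?E2 (?c2 u')" "(?c2 u', b) \<in> ?E2"
        unfolding quot_mem_def by auto
      obtain x' y' where x': "x' \<in> D1" "R x' u'" "y' \<in> D1" "R y' v'"
        using tot2 u' by meson
      have "?c1 y' = ?c1 x" "mem1 x' y'"
        using class12[of y' x v' u] mem[of x' y' u' v'] x' u' 1(2-5) by auto
      then have "(?c1 x', ?c1 x) \<in> ?E1"
        unfolding quot_mem_def using x' by blast
      moreover have "z = collapse ?E1 (?c1 x')"
        using 1(1)[of "?c2 u'" x' u'] x' u' by simp
      ultimately show "z \<in> collapse ?E1 ` {a. (a, ?c1 x) \<in> ?E1}"
        by blast
    qed
    then show ?case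
      using collapse_unfold[OF wf1, where 'b='v] collapse_unfold[OF wf2, where 'b='v] by metis
  qed
  show "x \<in> D1 \<Longrightarrow> u \<in> D2 \<Longrightarrow> R x u \<Longrightarrow> (collapse ?E1 (?c1 x) :: 'v) = collapse ?E2 (?c2 u)"
    using step by blast
qed

section \<open>Generic chains\<close>

text \<open>
  Transfinite recursion along a well-order of the requirements \<open>I\<close> whose order type is the cardinal of
  \<open>I\<close>. Proper initial segments then have size at most \<open>|K|\<close>, so closure provides a lower bound of the
  earlier choices, and density an extension of it that meets the next requirement.
\<close>

lemma generic_chain_exists:
  fixes le :: "'q \<Rightarrow> 'q \<Rightarrow> bool" and dense :: "'d \<Rightarrow> 'q set" and K :: "'k set"
  assumes refl: "\<And>q. q \<in> Q \<Longrightarrow> le q q"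
    and trans: "\<And>p q r. le r q \<Longrightarrow> le q p \<Longrightarrow> le r p"
    and closed: "\<And>C. C \<subseteq> Q \<Longrightarrow> |C| \<le>o |K| \<Longrightarrow> (\<forall>p\<in>C. \<forall>q\<in>C. le p q \<or> le q p) \<Longrightarrow>
      \<exists>r\<in>Q. \<forall>p\<in>C. le r p"
    and dense: "\<And>d q. d \<in> I \<Longrightarrow> q \<in> Q \<Longrightarrow> \<exists>r\<in>Q. r \<in> dense d \<and> le r q"
    and card: "|I| \<le>o cardSuc |K|"
  obtains G where "G \<subseteq> Q" "\<And>p q. p \<in> G \<Longrightarrow> q \<in> G \<Longrightarrow> le p q \<or> le q p"
    and "\<And>d. d \<in> I \<Longrightarrow> \<exists>q\<in>G. q \<in> dense d"
proof -
  \<comment> \<open>The relation \<open>|I|\<close> is itself a well-order of \<open>I\<close> of least order type.\<close>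
  let ?r = "|I|"
  let ?S = "?r - Id"
  have wo: "well_order_on I ?r" and Field: "Field ?r = I"
    by (rule card_of_well_order_on, rule Field_card_of)
  then have wf: "wf ?S"
    by (simp add: well_order_on_def)
  have tot: "d = e \<or> (d, e) \<in> ?S \<or> (e, d) \<in> ?S" if "d \<in> I" "e \<in> I" for d e
    using wo that unfolding well_order_on_def linear_order_on_def total_on_def Field by auto
  define g where "g = wfrec ?S (\<lambda>f d. SOME q. q \<in> Q \<and> q \<in> dense d \<and> (\<forall>e. (e, d) \<in> ?S \<longrightarrow> le q (f e)))"
  have g: "g d = (SOME q. q \<in> Q \<and> q \<in> dense d \<and> (\<forall>e. (e, d) \<in> ?S \<longrightarrow> le q (g e)))" for d
    unfolding g_def by (subst wfrec[OF wf]) (simp add: cut_apply cong: conj_cong)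
  have "g d \<in> Q \<and> g d \<in> dense d \<and> (\<forall>e. (e, d) \<in> ?S \<longrightarrow> le (g d) (g e))" if "d \<in> I" for d
    using that
  proof (induction d rule: wf_induct_rule[OF wf])
    case (1 d)
    have below: "e \<in> I" if "(e, d) \<in> ?S" for e
      using that Field by (auto simp: Field_def)
    let ?C = "g ` {e. (e, d) \<in> ?S}"
    have "\<exists>p\<in>Q. \<forall>q\<in>?C. le p q"
    proof (rule closed)
      show "?C \<subseteq> Q"
        using 1(1) below by blast
      show "|?C| \<le>o |K|"
      proof -
        have "{e. (e, d) \<in> ?S} = underS ?r d"
          unfolding underS_def by auto
        then have "|{e. (e, d) \<in> ?S}| <o ?r"
          using card_of_underS[OF card_of_Card_order, of d I] 1(2) Field by simp
        then have "|{e. (e, d) \<in> ?S}| <o cardSuc |K|"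
          using card ordLess_ordLeq_trans by blast
        then have "|{e. (e, d) \<in> ?S}| \<le>o |K|"
          by (simp add: cardSuc_ordLeq_ordLess[OF card_of_Card_order card_of_Card_order])
        then show ?thesis
          using card_of_image ordLeq_transitive by blast
      qed
      show "\<forall>p\<in>?C. \<forall>q\<in>?C. le p q \<or> le q p"
      proof clarify
        fix e e' assume e: "(e, d) \<in> ?r" "(e', d) \<in> ?r" "e \<noteq> d" "e' \<noteq> d" "\<not> le (g e') (g e)"
        then have "(e, d) \<in> ?S" "(e', d) \<in> ?S"
          by auto
        then show "le (g e) (g e')"
          using 1(1) tot[of e e'] refl below e(5) by blast
      qed
    qed
    then obtain p where p: "p \<in> Q" "\<forall>q\<in>?C. le p q"
      by blast
    then obtain q where q: "q \<in> Q" "q \<in> dense d" "le q p"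
      using dense 1(2) by blast
    have "le q (g e)" if "(e, d) \<in> ?S" for e
      using that p(2) by (intro trans[OF q(3)]) blast
    then have "\<exists>q. q \<in> Q \<and> q \<in> dense d \<and> (\<forall>e. (e, d) \<in> ?S \<longrightarrow> le q (g e))"
      using q by blast
    from someI_ex[OF this] show ?case
      using g[of d] by simp
  qed
  note gI = this
  show thesis
  proof (rule that[of "g ` I"])
    show "g ` I \<subseteq> Q"
      using gI by blast
    show "le p q \<or> le q p" if "p \<in> g ` I" "q \<in> g ` I" for p q
    proof -
      obtain d e where "d \<in> I" "e \<in> I" "p = g d" "q = g e"
        using \<open>p \<in> g ` I\<close> \<open>q \<in> g ` I\<close> by blast
      then show ?thesis
        using tot[of d e] gI[of d] gI[of e] refl by blast
    qed
    show "\<exists>q\<in>g ` I. q \<in> dense d" if "d \<in> I" for d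
      using gI[OF \<open>d \<in> I\<close>] \<open>d \<in> I\<close> by blast
  qed
qed

section \<open>Cardinality\<close>

lemma lesspoll_iff_ordLess: "A \<prec> B \<longleftrightarrow> |A| <o |B|"
proof -
  have "A \<lesssim> B \<longleftrightarrow> |A| \<le>o |B|"
    by (simp add: lepoll_def card_of_ordLeq)
  then show ?thesis
    unfolding lesspoll_def eqpoll_iff_card_of_ordIso
    using ordLeq_iff_ordLess_or_ordIso not_ordLess_ordIso by blast
qed

lemma lepoll_iff_ordLeq: "A \<lesssim> B \<longleftrightarrow> |A| \<le>o |B|"
  by (simp add: lepoll_def card_of_ordLeq)

lemma lesspoll_iff_not_lepoll: "A \<prec> B \<longleftrightarrow> \<not> B \<lesssim> A"
  unfolding lesspoll_iff_ordLess lepoll_iff_ordLeq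
  by (simp add: not_ordLeq_iff_ordLess card_of_Well_order)

lemma lesspoll_Un_infinite:
  "infinite C \<Longrightarrow> A \<prec> C \<Longrightarrow> B \<prec> C \<Longrightarrow> A \<union> B \<prec> C"
  unfolding lesspoll_iff_ordLess by (rule card_of_Un_ordLess_infinite)

lemma lesspoll_insert_infinite: "infinite C \<Longrightarrow> A \<prec> C \<Longrightarrow> insert x A \<prec> C"
  using lesspoll_Un_infinite[of C "{x}" A] finite_lesspoll_infinite[of C "{x}"] by simp

lemma image_lesspoll: "A \<prec> C \<Longrightarrow> f ` A \<prec> C"
  using image_lepoll lesspoll_trans1 by blast

section \<open>Ordinals\<close>

lemma ordinal_mem: "ordinal x \<Longrightarrow> y \<in> elts x \<Longrightarrow> ordinal y"
  unfolding ordinal_def transitive_set_def by blast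

text \<open>
  Double induction on membership: if neither of \<open>x\<close> and \<open>y\<close> is an element of the other, then the two
  induction hypotheses show that they have the same elements.
\<close>

lemma ordinal_linear:
  fixes x y :: "'v::zfc_universe"
  assumes "ordinal x" "ordinal y"
  shows "x \<in> elts y \<or> x = y \<or> y \<in> elts x"
  using assms
proof (induction x arbitrary: y rule: wf_induct_rule[OF foundation])
  case (1 x)
  note IHx = 1(1) and x = 1(2)
  show ?case
    using 1(3)
  proof (induction y rule: wf_induct_rule[OF foundation])
    case (1 y)
    have xz: "z \<in> elts y \<or> z = y \<or> y \<in> elts z" if "z \<in> elts x" for z
      using IHx[of z y] that x 1(2) ordinal_mem by blast
    have yz: "x \<in> elts z \<or> x = z \<or> z \<in> elts x" if "z \<in> elts y" for z
      using 1(1)[of z] that 1(2) ordinal_mem by blast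
    show ?case
    proof (rule ccontr)
      assume *: "\<not> ?thesis"
      have trans: "\<And>z w. z \<in> elts x \<Longrightarrow> w \<in> elts z \<Longrightarrow> w \<in> elts x"
        "\<And>z w. z \<in> elts y \<Longrightarrow> w \<in> elts z \<Longrightarrow> w \<in> elts y"
        using x 1(2) unfolding ordinal_def transitive_set_def by blast+
      have "elts x = elts y"
        using * xz yz trans by blast
      then show False
        using * extensionality by blast
    qed
  qed
qed

section \<open>Normal measures\<close>

locale normal_measure_on =
  fixes \<kappa> :: "'v::zfc_universe" and \<mu> :: "'v set set"
  assumes cardinal: "cardinal \<kappa>"
    and uncountable: "uncountable (elts \<kappa>)"
    and normal: "normal_measure \<kappa> \<mu>"
begin

text \<open>
  The measure as a filter, so that \<open>eventually\<close> reads as "for almost all \<open>\<alpha>\<close>".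
\<close>

definition ae :: "'v filter"
  where "ae = Abs_filter (\<lambda>P. {\<alpha> \<in> elts \<kappa>. P \<alpha>} \<in> \<mu>)"

lemma infinite: "infinite (elts \<kappa>)"
  using uncountable countable_finite by blast

lemma ultrafilter: "ultrafilter_on (Pow (elts \<kappa>)) (\<lambda>X. elts \<kappa> - X) \<mu>"
  using normal by (simp add: normal_measure_def complete_nonprincipal_ultrafilter_def)

lemma measure_mono: "A \<in> \<mu> \<Longrightarrow> A \<subseteq> B \<Longrightarrow> B \<subseteq> elts \<kappa> \<Longrightarrow> B \<in> \<mu>"
  using ultrafilter unfolding ultrafilter_on_def by blast

lemma eventually_ae: "eventually P ae \<longleftrightarrow> {\<alpha> \<in> elts \<kappa>. P \<alpha>} \<in> \<mu>"
  unfolding ae_def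
proof (rule eventually_Abs_filter, unfold_locales)
  obtain A where "A \<in> \<mu>" "A \<subseteq> elts \<kappa>"
    using ultrafilter unfolding ultrafilter_on_def by blast
  then have "elts \<kappa> \<in> \<mu>"
    using measure_mono by blast
  then show "{\<alpha> \<in> elts \<kappa>. True} \<in> \<mu>"
    by simp
next
  fix P Q assume "{\<alpha> \<in> elts \<kappa>. P \<alpha>} \<in> \<mu>" "{\<alpha> \<in> elts \<kappa>. Q \<alpha>} \<in> \<mu>"
  then have "{\<alpha> \<in> elts \<kappa>. P \<alpha>} \<inter> {\<alpha> \<in> elts \<kappa>. Q \<alpha>} \<in> \<mu>"
    using ultrafilter unfolding ultrafilter_on_def by blast
  moreover have "{\<alpha> \<in> elts \<kappa>. P \<alpha>} \<inter> {\<alpha> \<in> elts \<kappa>. Q \<alpha>} = {\<alpha> \<in> elts \<kappa>. P \<alpha> \<and> Q \<alpha>}"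
    by auto
  ultimately show "{\<alpha> \<in> elts \<kappa>. P \<alpha> \<and> Q \<alpha>} \<in> \<mu>"
    by simp
next
  fix P Q assume "\<forall>\<alpha>. P \<alpha> \<longrightarrow> Q \<alpha>" "{\<alpha> \<in> elts \<kappa>. P \<alpha>} \<in> \<mu>"
  then show "{\<alpha> \<in> elts \<kappa>. Q \<alpha>} \<in> \<mu>"
    by (auto intro: measure_mono)
qed

lemma ae_in_cardinal: "\<forall>\<^sub>F \<alpha> in ae. \<alpha> \<in> elts \<kappa>"
proof -
  have "\<forall>\<^sub>F \<alpha> in ae. True"
    by simp
  then show ?thesis
    unfolding eventually_ae by simp
qed

lemma ae_not_False: "\<not> (\<forall>\<^sub>F \<alpha> in ae. False)"
  using ultrafilter by (simp add: eventually_ae ultrafilter_on_def)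

lemma ae_exE:
  assumes "\<forall>\<^sub>F \<alpha> in ae. P \<alpha>"
  obtains \<alpha> where "\<alpha> \<in> elts \<kappa>" "P \<alpha>"
proof -
  have "{\<alpha> \<in> elts \<kappa>. P \<alpha>} \<noteq> {}"
    using assms ultrafilter unfolding eventually_ae ultrafilter_on_def by metis
  then show thesis
    using that by blast
qed

lemma ae_ultra: "(\<forall>\<^sub>F \<alpha> in ae. P \<alpha>) \<or> (\<forall>\<^sub>F \<alpha> in ae. \<not> P \<alpha>)"
proof -
  have "{\<alpha> \<in> elts \<kappa>. P \<alpha>} \<in> Pow (elts \<kappa>)"
    "elts \<kappa> - {\<alpha> \<in> elts \<kappa>. P \<alpha>} = {\<alpha> \<in> elts \<kappa>. \<not> P \<alpha>}"
    by auto
  then show ?thesis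
    using ultrafilter unfolding eventually_ae ultrafilter_on_def by metis
qed

text \<open>
  Completeness of the measure. Only the number of indices is restricted, not that of distinct sets.
\<close>

lemma ae_ball:
  assumes "I \<prec> elts \<kappa>" "\<And>i. i \<in> I \<Longrightarrow> \<forall>\<^sub>F \<alpha> in ae. P i \<alpha>"
  shows "\<forall>\<^sub>F \<alpha> in ae. \<forall>i\<in>I. P i \<alpha>"
proof (cases "I = {}")
  case False
  let ?F = "(\<lambda>i. {\<alpha> \<in> elts \<kappa>. P i \<alpha>}) ` I"
  have "?F \<subseteq> \<mu>" "?F \<noteq> {}" "?F \<prec> elts \<kappa>"
    using assms False by (auto simp: eventually_ae image_lesspoll)
  then have "\<Inter>?F \<in> \<mu>"
    using normal unfolding normal_measure_def complete_nonprincipal_ultrafilter_def by blast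
  moreover have "\<Inter>?F = {\<alpha> \<in> elts \<kappa>. \<forall>i\<in>I. P i \<alpha>}"
    using False by auto
  ultimately show ?thesis
    by (simp add: eventually_ae)
qed simp

text \<open>
  Normality. The quantifier ranges over the \<open>\<alpha>\<close> many indices below the point \<open>\<alpha>\<close> itself, which is
  what makes \<open>\<kappa>\<close> many requirements manageable at once.
\<close>

lemma ae_diagonal:
  assumes "\<And>i. i \<in> elts \<kappa> \<Longrightarrow> \<forall>\<^sub>F \<alpha> in ae. P i \<alpha>"
  shows "\<forall>\<^sub>F \<alpha> in ae. \<forall>i\<in>elts \<alpha>. P i \<alpha>"
proof -
  have "\<forall>A. (\<forall>\<alpha> \<in> elts \<kappa>. A \<alpha> \<in> \<mu>) \<longrightarrow> {\<beta> \<in> elts \<kappa>. \<forall>\<alpha> \<in> elts \<beta>. \<beta> \<in> A \<alpha>} \<in> \<mu>"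
    using normal by (simp add: normal_measure_def)
  from spec[OF this, of "\<lambda>\<alpha>. {\<beta> \<in> elts \<kappa>. P \<alpha> \<beta>}"]
  have "{\<beta> \<in> elts \<kappa>. \<forall>\<alpha>\<in>elts \<beta>. \<beta> \<in> {\<beta> \<in> elts \<kappa>. P \<alpha> \<beta>}} \<in> \<mu>"
    using assms unfolding eventually_ae by blast
  moreover have "{\<beta> \<in> elts \<kappa>. \<forall>\<alpha>\<in>elts \<beta>. \<beta> \<in> {\<beta> \<in> elts \<kappa>. P \<alpha> \<beta>}} =
      {\<beta> \<in> elts \<kappa>. \<forall>\<alpha>\<in>elts \<beta>. P \<alpha> \<beta>}"
    by blast
  ultimately show ?thesis
    by (simp add: eventually_ae)
qed

lemma ae_neq: "\<gamma> \<in> elts \<kappa> \<Longrightarrow> \<forall>\<^sub>F \<alpha> in ae. \<alpha> \<noteq> \<gamma>"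
proof -
  assume "\<gamma> \<in> elts \<kappa>"
  then have "{\<alpha> \<in> elts \<kappa>. \<alpha> = \<gamma>} = {\<gamma>}"
    by blast
  then have "\<not> (\<forall>\<^sub>F \<alpha> in ae. \<alpha> = \<gamma>)"
    using normal \<open>\<gamma> \<in> elts \<kappa>\<close>
    unfolding normal_measure_def complete_nonprincipal_ultrafilter_def eventually_ae by auto
  then show ?thesis
    using ae_ultra by blast
qed

lemma ordinal_kappa: "ordinal \<kappa>"
  using cardinal by (simp add: cardinal_def)

lemma elts_subset: "\<alpha> \<in> elts \<kappa> \<Longrightarrow> elts \<alpha> \<subseteq> elts \<kappa>"
  using ordinal_kappa by (simp add: ordinal_def transitive_set_def)

lemma elts_trans: "\<alpha> \<in> elts \<beta> \<Longrightarrow> \<beta> \<in> elts \<kappa> \<Longrightarrow> elts \<alpha> \<subseteq> elts \<beta>"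
  using ordinal_kappa unfolding ordinal_def transitive_set_def by blast

lemma elts_lesspoll: "\<alpha> \<in> elts \<kappa> \<Longrightarrow> elts \<alpha> \<prec> elts \<kappa>"
  using cardinal elts_subset subset_imp_lepoll unfolding cardinal_def lesspoll_def by blast

lemma linear: "\<alpha> \<in> elts \<kappa> \<Longrightarrow> \<beta> \<in> elts \<kappa> \<Longrightarrow> \<alpha> \<in> elts \<beta> \<or> \<alpha> = \<beta> \<or> \<beta> \<in> elts \<alpha>"
  using ordinal_linear ordinal_mem ordinal_kappa by blast

text \<open>
  The points that are not above \<open>\<gamma>\<close> are \<open>\<gamma>\<close> and its elements, fewer than \<open>\<kappa>\<close> in number, and each single
  point is negligible.
\<close>

lemma ae_above:
  assumes "\<gamma> \<in> elts \<kappa>"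
  shows "\<forall>\<^sub>F \<alpha> in ae. \<gamma> \<in> elts \<alpha>"
proof -
  have "\<forall>\<^sub>F \<alpha> in ae. \<forall>\<beta>\<in>elts \<gamma>. \<alpha> \<noteq> \<beta>"
    using assms elts_lesspoll elts_subset by (intro ae_ball ae_neq) auto
  then show ?thesis
    using ae_neq[OF assms] ae_in_cardinal
  proof eventually_elim
    case (elim \<alpha>)
    then show ?case
      using linear[OF assms, of \<alpha>] by blast
  qed
qed

text \<open>
  Regularity of \<open>\<kappa>\<close>: almost every point lies above all elements of \<open>S\<close>.
\<close>

lemma bounded:
  assumes "S \<subseteq> elts \<kappa>" "S \<prec> elts \<kappa>"
  obtains \<gamma> where "\<gamma> \<in> elts \<kappa>" "S \<subseteq> elts \<gamma>"
proof -
  have "\<forall>\<^sub>F \<alpha> in ae. \<forall>s\<in>S. s \<in> elts \<alpha>"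
    using assms by (intro ae_ball ae_above) auto
  then obtain \<gamma> where "\<gamma> \<in> elts \<kappa>" "\<forall>s\<in>S. s \<in> elts \<gamma>"
    by (rule ae_exE)
  then show thesis
    using that by blast
qed

text \<open>
  Given \<open>\<kappa>\<close> many distinct subsets \<open>g \<alpha>\<close> of \<open>A\<close>, the measure decides for each \<open>a\<close> in \<open>A\<close> whether \<open>a \<in> g \<alpha>\<close>
  for almost all \<open>\<alpha>\<close>. By completeness almost all \<open>g \<alpha>\<close> are equal to the set of the \<open>a\<close> decided positively,
  contradicting injectivity.
\<close>

lemma strong_limit:
  assumes "A \<prec> elts \<kappa>"
  shows "Pow A \<prec> elts \<kappa>"
proof (rule ccontr)
  assume "\<not> ?thesis"
  then have "elts \<kappa> \<lesssim> Pow A"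
    by (simp add: lesspoll_iff_not_lepoll)
  then obtain g where g: "inj_on g (elts \<kappa>)" "g ` elts \<kappa> \<subseteq> Pow A"
    unfolding lepoll_def by blast
  define E where "E = {a \<in> A. \<forall>\<^sub>F \<alpha> in ae. a \<in> g \<alpha>}"
  have "\<forall>\<^sub>F \<alpha> in ae. \<forall>a\<in>A. a \<in> g \<alpha> \<longleftrightarrow> a \<in> E"
  proof (rule ae_ball[OF assms])
    fix a assume "a \<in> A"
    then show "\<forall>\<^sub>F \<alpha> in ae. a \<in> g \<alpha> \<longleftrightarrow> a \<in> E"
      using ae_ultra[of "\<lambda>\<alpha>. a \<in> g \<alpha>"] ae_not_False unfolding E_def
      by (cases "\<forall>\<^sub>F \<alpha> in ae. a \<in> g \<alpha>") (auto elim: eventually_mono)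
  qed
  then have E: "\<forall>\<^sub>F \<alpha> in ae. \<alpha> \<in> elts \<kappa> \<and> g \<alpha> = E"
    using ae_in_cardinal by eventually_elim (use g(2) E_def in blast)
  obtain \<gamma> where \<gamma>: "\<gamma> \<in> elts \<kappa>" "g \<gamma> = E"
    using ae_exE[OF E] by blast
  have "\<forall>\<^sub>F \<alpha> in ae. False"
    using E ae_neq[OF \<gamma>(1)]
  proof eventually_elim
    case (elim \<alpha>)
    then show ?case
      using g(1) \<gamma> by (auto simp: inj_on_def)
  qed
  then show False
    using ae_not_False by blast
qed

lemma quot_class_up_eq_iff:
  assumes "f \<in> up_dom \<kappa>" "g \<in> up_dom \<kappa>"
  shows "quot_class (up_dom \<kappa>) (up_eq \<kappa> \<mu>) f = quot_class (up_dom \<kappa>) (up_eq \<kappa> \<mu>) g \<longleftrightarrow> up_eq \<kappa> \<mu> f g"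
proof
  have "up_eq \<kappa> \<mu> g g"
    using ae_in_cardinal by (simp add: up_eq_def eventually_ae)
  moreover assume "quot_class (up_dom \<kappa>) (up_eq \<kappa> \<mu>) f = quot_class (up_dom \<kappa>) (up_eq \<kappa> \<mu>) g"
  ultimately show "up_eq \<kappa> \<mu> f g"
    using assms unfolding quot_class_def by blast
next
  assume "up_eq \<kappa> \<mu> f g"
  then have fg: "\<forall>\<^sub>F \<alpha> in ae. f \<alpha> = g \<alpha>"
    by (simp add: up_eq_def eventually_ae)
  have "(\<forall>\<^sub>F \<alpha> in ae. f \<alpha> = h \<alpha>) \<longleftrightarrow> (\<forall>\<^sub>F \<alpha> in ae. g \<alpha> = h \<alpha>)" for h
  proof
    show "\<forall>\<^sub>F \<alpha> in ae. g \<alpha> = h \<alpha>" if "\<forall>\<^sub>F \<alpha> in ae. f \<alpha> = h \<alpha>"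
      using fg that by eventually_elim simp
    show "\<forall>\<^sub>F \<alpha> in ae. f \<alpha> = h \<alpha>" if "\<forall>\<^sub>F \<alpha> in ae. g \<alpha> = h \<alpha>"
      using fg that by eventually_elim simp
  qed
  then show "quot_class (up_dom \<kappa>) (up_eq \<kappa> \<mu>) f = quot_class (up_dom \<kappa>) (up_eq \<kappa> \<mu>) g"
    unfolding quot_class_def up_eq_def eventually_ae by blast
qed

text \<open>
  A descending sequence of classes would, by countable completeness, descend at almost every coordinate,
  contradicting foundation.
\<close>

lemma wf_ultrapower: "wf (quot_mem (up_dom \<kappa>) (up_eq \<kappa> \<mu>) (up_mem \<kappa> \<mu>))"
  unfolding wf_iff_no_infinite_down_chain
proof
  let ?c = "quot_class (up_dom \<kappa>) (up_eq \<kappa> \<mu>)"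
  assume "\<exists>s. \<forall>i. (s (Suc i), s i) \<in> quot_mem (up_dom \<kappa>) (up_eq \<kappa> \<mu>) (up_mem \<kappa> \<mu>)"
  then obtain s where "\<forall>i. \<exists>x y. s (Suc i) = ?c x \<and> s i = ?c y \<and> x \<in> up_dom \<kappa> \<and> y \<in> up_dom \<kappa> \<and> up_mem \<kappa> \<mu> x y"
    unfolding quot_mem_def by auto
  then obtain x y where xy: "\<And>i. s (Suc i) = ?c (x i)" "\<And>i. s i = ?c (y i)" "\<And>i. y i \<in> up_dom \<kappa>"
    "\<And>i. up_mem \<kappa> \<mu> (x i) (y i)"
    by metis
  have "\<forall>\<^sub>F \<alpha> in ae. y (Suc i) \<alpha> \<in> elts (y i \<alpha>)" for i
  proof -
    have "y (Suc i) \<in> ?c (y (Suc i))"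
      using xy(3) ae_in_cardinal by (simp add: quot_class_def up_eq_def eventually_ae)
    then have "y (Suc i) \<in> ?c (x i)"
      using xy(1)[of i] xy(2)[of "Suc i"] by simp
    then have "up_eq \<kappa> \<mu> (x i) (y (Suc i))"
      by (simp add: quot_class_def)
    then have "\<forall>\<^sub>F \<alpha> in ae. x i \<alpha> = y (Suc i) \<alpha>" "\<forall>\<^sub>F \<alpha> in ae. x i \<alpha> \<in> elts (y i \<alpha>)"
      using xy(4) by (simp_all add: up_eq_def up_mem_def eventually_ae)
    then show ?thesis
      by eventually_elim simp
  qed
  moreover have "(UNIV :: nat set) \<prec> elts \<kappa>"
    unfolding lesspoll_iff_not_lepoll
    using uncountable countable_lepoll[of "UNIV :: nat set" "elts \<kappa>"] by blast
  ultimately have "\<forall>\<^sub>F \<alpha> in ae. \<forall>i\<in>UNIV. y (Suc i) \<alpha> \<in> elts (y i \<alpha>)"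
    by (intro ae_ball)
  moreover have "\<not> (\<forall>i. y (Suc i) \<alpha> \<in> elts (y i \<alpha>))" for \<alpha>
    using foundation[where 'a='v] unfolding wf_iff_no_infinite_down_chain
    by (auto dest: spec[of _ "\<lambda>i. y i \<alpha>"])
  ultimately show False
    using ae_not_False by simp
qed

end

section \<open>The forcing adding a Cohen subset of a measurable cardinal\<close>

abbreviation zero_bit :: "'v::zfc_universe" ("\<zero>")
  where "\<zero> \<equiv> vset {}"

abbreviation one_bit :: "'v::zfc_universe" ("\<one>")
  where "\<one> \<equiv> vset {vset {}}"

lemma bits_distinct [simp]: "\<zero> \<noteq> \<one>" "\<one> \<noteq> \<zero>"
proof -
  have "elts \<zero> = {}"
    by (simp add: small_empty)
  then show "\<zero> \<noteq> \<one>" "\<one> \<noteq> \<zero>"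
    using elts_vset_singleton[of \<zero>] by (metis insert_not_empty)+
qed

definition functional :: "'v::zfc_universe set \<Rightarrow> bool"
  where "functional A \<longleftrightarrow> (\<forall>\<alpha> i j. vpair \<alpha> i \<in> A \<and> vpair \<alpha> j \<in> A \<longrightarrow> i = j)"

definition bit_pairs :: "'v set \<Rightarrow> 'v::zfc_universe set"
  where "bit_pairs A = (\<lambda>\<alpha>. vpair \<alpha> \<zero>) ` A \<union> (\<lambda>\<alpha>. vpair \<alpha> \<one>) ` A"

lemma vpair_in_bit_pairs [simp]: "vpair \<alpha> i \<in> bit_pairs A \<longleftrightarrow> \<alpha> \<in> A \<and> (i = \<zero> \<or> i = \<one>)"
  by (auto simp: bit_pairs_def)

lemma bit_pairs_mono: "A \<subseteq> B \<Longrightarrow> bit_pairs A \<subseteq> bit_pairs B"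
  by (auto simp: bit_pairs_def)

lemma small_bit_pairs: "small A \<Longrightarrow> small (bit_pairs A)"
  unfolding bit_pairs_def by (intro small_Un small_image)

text \<open>
  The condition that \<open>\<alpha>\<close> is the first place at which the generic function has value \<open>1\<close>.
\<close>

definition first_one :: "'v \<Rightarrow> 'v::zfc_universe"
  where "first_one \<alpha> = vset (insert (vpair \<alpha> \<one>) ((\<lambda>\<beta>. vpair \<beta> \<zero>) ` elts \<alpha>))"

lemma elts_first_one: "elts (first_one \<alpha>) = insert (vpair \<alpha> \<one>) ((\<lambda>\<beta>. vpair \<beta> \<zero>) ` elts \<alpha>)"
  unfolding first_one_def by (intro elts_vset small_insert small_image small_elts)

lemma not_self_mem: "x \<notin> elts x"
  using wf_not_refl[OF foundation, of x] by simp

lemma functional_first_one: "functional (elts (first_one \<alpha>))"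
  unfolding functional_def elts_first_one by (auto simp: not_self_mem)

context normal_measure_on
begin

abbreviation conditions :: "'v set" ("\<P>")
  where "\<P> \<equiv> cohen_conditions \<kappa>"

lemma bit_pairs_lesspoll: "A \<prec> elts \<kappa> \<Longrightarrow> bit_pairs A \<prec> elts \<kappa>"
  unfolding bit_pairs_def by (intro lesspoll_Un_infinite infinite image_lesspoll)

text \<open>
  By regularity and since elements of \<open>\<kappa>\<close> have size less than \<open>\<kappa>\<close>, the bound on the size of a condition
  amounts to a bound on its domain.
\<close>

lemma condition_iff:
  "p \<in> \<P> \<longleftrightarrow> functional (elts p) \<and> (\<exists>\<gamma>\<in>elts \<kappa>. elts p \<subseteq> bit_pairs (elts \<gamma>))"
proof
  assume p: "p \<in> \<P>"
  then have sub: "elts p \<subseteq> bit_pairs (elts \<kappa>)" and fn: "functional (elts p)" and lp: "elts p \<prec> elts \<kappa>"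
    by (auto simp: cohen_conditions_def functional_def bit_pairs_def)
  define dom where "dom = (\<lambda>x. THE \<alpha>. \<exists>i. x = vpair \<alpha> i) ` elts p"
  have dom: "\<alpha> \<in> dom" if "vpair \<alpha> i \<in> elts p" for \<alpha> i
    unfolding dom_def by (rule image_eqI[OF _ that]) simp
  have "dom \<subseteq> elts \<kappa>"
    using sub by (auto simp: dom_def bit_pairs_def)
  moreover have "dom \<prec> elts \<kappa>"
    unfolding dom_def by (rule image_lesspoll[OF lp])
  ultimately obtain \<gamma> where "\<gamma> \<in> elts \<kappa>" "dom \<subseteq> elts \<gamma>"
    by (rule bounded)
  then show "functional (elts p) \<and> (\<exists>\<gamma>\<in>elts \<kappa>. elts p \<subseteq> bit_pairs (elts \<gamma>))"
    using fn sub dom unfolding bit_pairs_def by blast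
next
  assume "functional (elts p) \<and> (\<exists>\<gamma>\<in>elts \<kappa>. elts p \<subseteq> bit_pairs (elts \<gamma>))"
  then obtain \<gamma> where fn: "functional (elts p)" and \<gamma>: "\<gamma> \<in> elts \<kappa>" "elts p \<subseteq> bit_pairs (elts \<gamma>)"
    by blast
  have "elts p \<subseteq> bit_pairs (elts \<kappa>)"
    using \<gamma>(2) bit_pairs_mono[OF elts_subset[OF \<gamma>(1)]] by (rule subset_trans)
  moreover have "elts p \<prec> elts \<kappa>"
    using subset_imp_lepoll[OF \<gamma>(2)] bit_pairs_lesspoll[OF elts_lesspoll[OF \<gamma>(1)]]
    by (rule lesspoll_trans1)
  ultimately show "p \<in> \<P>"
    using fn unfolding cohen_conditions_def functional_def bit_pairs_def by blast
qed

lemma small_conditions: "small \<P>"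
proof (rule small_subset)
  show "small {x. elts x \<subseteq> bit_pairs (elts \<kappa>)}"
    by (intro small_Pow small_bit_pairs small_elts)
  show "\<P> \<subseteq> {x. elts x \<subseteq> bit_pairs (elts \<kappa>)}"
    using condition_iff bit_pairs_mono elts_subset by blast
qed

lemma first_one_condition: "\<alpha> \<in> elts \<kappa> \<Longrightarrow> first_one \<alpha> \<in> \<P>"
proof -
  assume \<alpha>: "\<alpha> \<in> elts \<kappa>"
  obtain \<gamma> where \<gamma>: "\<gamma> \<in> elts \<kappa>" "\<alpha> \<in> elts \<gamma>"
    using ae_exE[OF ae_above[OF \<alpha>]] by blast
  then have "elts (first_one \<alpha>) \<subseteq> bit_pairs (elts \<gamma>)"
    using elts_trans by (auto simp: elts_first_one bit_pairs_def)
  then show ?thesis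
    using \<gamma> functional_first_one condition_iff by blast
qed

text \<open>
  If \<open>\<alpha> < \<beta>\<close>, then the value at \<open>\<alpha>\<close> is \<open>1\<close> according to one condition and \<open>0\<close> according to the other.
\<close>

lemma first_one_incompatible:
  assumes "\<alpha> \<in> elts \<kappa>" "\<beta> \<in> elts \<kappa>" "\<alpha> \<noteq> \<beta>"
    and "functional A" "elts (first_one \<alpha>) \<subseteq> A" "elts (first_one \<beta>) \<subseteq> A"
  shows False
proof -
  have "vpair \<alpha> \<one> \<in> A" "vpair \<beta> \<one> \<in> A"
    using assms(5,6) by (auto simp: elts_first_one)
  moreover have "vpair \<alpha> \<zero> \<in> A \<or> vpair \<beta> \<zero> \<in> A"
    using linear[OF assms(1,2)] assms(3,5,6) by (auto simp: elts_first_one)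
  ultimately show False
    using assms(4) bits_distinct unfolding functional_def by blast
qed

lemma union_condition:
  assumes "A \<subseteq> \<P>" "A \<prec> elts \<kappa>" "functional (\<Union> (elts ` A))"
  shows "small (\<Union> (elts ` A))" "vset (\<Union> (elts ` A)) \<in> \<P>"
proof -
  have "\<forall>p\<in>A. \<exists>\<gamma>. \<gamma> \<in> elts \<kappa> \<and> elts p \<subseteq> bit_pairs (elts \<gamma>)"
    using assms(1) condition_iff by blast
  then obtain g where g: "\<And>p. p \<in> A \<Longrightarrow> g p \<in> elts \<kappa> \<and> elts p \<subseteq> bit_pairs (elts (g p))"
    by metis
  have "g ` A \<subseteq> elts \<kappa>"
    using g by blast
  then obtain \<gamma> where \<gamma>: "\<gamma> \<in> elts \<kappa>" "g ` A \<subseteq> elts \<gamma>"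
    using bounded image_lesspoll[OF assms(2)] by metis
  have "elts p \<subseteq> bit_pairs (elts \<gamma>)" if "p \<in> A" for p
    using g[OF that] bit_pairs_mono[OF elts_trans[OF _ \<gamma>(1)], of "g p"] \<gamma>(2) that by blast
  then have sub: "\<Union> (elts ` A) \<subseteq> bit_pairs (elts \<gamma>)"
    by blast
  then show small: "small (\<Union> (elts ` A))"
    using small_subset[OF small_bit_pairs[OF small_elts]] by blast
  show "vset (\<Union> (elts ` A)) \<in> \<P>"
    unfolding condition_iff elts_vset[OF small] using assms(3) sub \<gamma>(1) by blast
qed

text \<open>
  A condition is determined by the places where it is \<open>0\<close> and those where it is \<open>1\<close>, two bounded subsets
  of \<open>\<kappa>\<close>. There are only \<open>\<kappa>\<close> bounded subsets because \<open>\<kappa>\<close> is a strong limit.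
\<close>

lemma card_conditions: "|\<P>| \<le>o |elts \<kappa>|"
proof -
  let ?B = "\<Union>\<gamma>\<in>elts \<kappa>. Pow (elts \<gamma>)"
  let ?f = "\<lambda>p. ({\<alpha>. vpair \<alpha> \<zero> \<in> elts p}, {\<alpha>. vpair \<alpha> \<one> \<in> elts p})"
  have "|?B| \<le>o |elts \<kappa>|"
  proof (intro card_of_UNION_ordLeq_infinite infinite ballI)
    show "|elts \<kappa>| \<le>o |elts \<kappa>|"
      by (rule card_of_mono1) simp
    show "|Pow (elts \<gamma>)| \<le>o |elts \<kappa>|" if "\<gamma> \<in> elts \<kappa>" for \<gamma>
      using strong_limit[OF elts_lesspoll[OF that]]
      by (simp add: lesspoll_iff_ordLess ordLess_imp_ordLeq)
  qed
  then have "|?B \<times> ?B| \<le>o |elts \<kappa>|"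
    by (intro card_of_Times_ordLeq_infinite_Field)
      (auto simp: infinite Field_card_of card_of_card_order_on)
  moreover have "|\<P>| \<le>o |?B \<times> ?B|"
    unfolding card_of_ordLeq[symmetric]
  proof (intro exI conjI)
    show "inj_on ?f \<P>"
    proof (rule inj_onI, rule extensionality)
      fix p q assume pq: "p \<in> \<P>" "q \<in> \<P>" "?f p = ?f q"
      have elts: "elts p = (\<lambda>\<alpha>. vpair \<alpha> \<zero>) ` fst (?f p) \<union> (\<lambda>\<alpha>. vpair \<alpha> \<one>) ` snd (?f p)"
        if "p \<in> \<P>" for p
        using that by (auto simp: condition_iff bit_pairs_def)
      show "elts p = elts q"
        using elts[OF pq(1)] elts[OF pq(2)] pq(3) by simp
    qed
    show "?f ` \<P> \<subseteq> ?B \<times> ?B"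
    proof (rule image_subsetI)
      fix p assume "p \<in> \<P>"
      then obtain \<gamma> where "\<gamma> \<in> elts \<kappa>" "elts p \<subseteq> bit_pairs (elts \<gamma>)"
        by (auto simp: condition_iff)
      then have "\<gamma> \<in> elts \<kappa>" "{\<alpha>. vpair \<alpha> \<zero> \<in> elts p} \<in> Pow (elts \<gamma>)"
        "{\<alpha>. vpair \<alpha> \<one> \<in> elts p} \<in> Pow (elts \<gamma>)"
        by (auto dest!: subsetD)
      then show "?f p \<in> ?B \<times> ?B"
        by blast
    qed
  qed
  ultimately show ?thesis
    using ordLeq_transitive by blast
qed

section \<open>Descending chains in the image forcing\<close>

text \<open>
  Functions from \<open>\<kappa>\<close> to conditions stand for the conditions of the image forcing in the ultrapower. The
  requirement on \<open>rooted\<close> functions says there that \<open>\<kappa>\<close>, which the identity function represents, is the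
  first place with value \<open>1\<close>.
\<close>

definition stronger :: "('v \<Rightarrow> 'v) \<Rightarrow> ('v \<Rightarrow> 'v) \<Rightarrow> bool"
  where "stronger q p \<longleftrightarrow> (\<forall>\<^sub>F \<alpha> in ae. elts (p \<alpha>) \<subseteq> elts (q \<alpha>))"

definition rooted :: "('v \<Rightarrow> 'v) set"
  where "rooted = {q. \<forall>\<alpha>\<in>elts \<kappa>. q \<alpha> \<in> \<P> \<and> elts (first_one \<alpha>) \<subseteq> elts (q \<alpha>)}"

lemma stronger_refl: "stronger q q"
  by (simp add: stronger_def)

lemma stronger_trans: "stronger r q \<Longrightarrow> stronger q p \<Longrightarrow> stronger r p"
  unfolding stronger_def by (erule (1) eventually_elim2) auto

lemma functional_condition: "p \<in> \<P> \<Longrightarrow> functional (elts p)"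
  by (simp add: condition_iff)

text \<open>
  A diagonal union: if \<open>c\<close> enumerates the chain, then \<open>r \<alpha>\<close> is the union of \<open>c i \<alpha>\<close> for \<open>i < \<alpha>\<close>. These are
  fewer than \<open>\<kappa>\<close> conditions, and by normality they are pairwise compatible for almost all \<open>\<alpha>\<close>, even
  though for each pair compatibility may fail at a negligible set of its own.
\<close>

lemma rooted_closed:
  assumes C: "C \<subseteq> rooted" "|C| \<le>o |elts \<kappa>|"
    and chain: "\<And>p q. p \<in> C \<Longrightarrow> q \<in> C \<Longrightarrow> stronger p q \<or> stronger q p"
  shows "\<exists>r\<in>rooted. \<forall>p\<in>C. stronger r p"
proof (cases "C = {}")
  case True
  have "first_one \<in> rooted"
    by (simp add: rooted_def first_one_condition)
  then show ?thesis
    using True by blast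
next
  case False
  then obtain c where c: "c ` elts \<kappa> = C"
    using C(2) card_of_ordLeq2[OF False, of "elts \<kappa>"] by metis
  have c_rooted: "c i \<alpha> \<in> \<P>" "elts (first_one \<alpha>) \<subseteq> elts (c i \<alpha>)"
    if "i \<in> elts \<kappa>" "\<alpha> \<in> elts \<kappa>" for i \<alpha>
    using C(1) c that by (auto simp: rooted_def)
  define compatible where "compatible \<alpha> \<longleftrightarrow>
    (\<forall>i\<in>elts \<alpha>. \<forall>k\<in>elts \<alpha>. functional (elts (c i \<alpha>) \<union> elts (c k \<alpha>)))" for \<alpha>
  have "\<forall>\<^sub>F \<alpha> in ae. functional (elts (c i \<alpha>) \<union> elts (c k \<alpha>))"
    if ik: "i \<in> elts \<kappa>" "k \<in> elts \<kappa>" for i k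
  proof -
    have "\<forall>\<^sub>F \<alpha> in ae. elts (c i \<alpha>) \<subseteq> elts (c k \<alpha>) \<or> elts (c k \<alpha>) \<subseteq> elts (c i \<alpha>)"
      using chain[of "c i" "c k"] ik c unfolding stronger_def by (auto elim: eventually_mono)
    then show ?thesis
      using ae_in_cardinal
    proof eventually_elim
      case (elim \<alpha>)
      then show ?case
        using c_rooted(1) ik functional_condition by (metis sup.absorb1 sup.absorb2)
    qed
  qed
  then have compatible: "\<forall>\<^sub>F \<alpha> in ae. compatible \<alpha>"
    unfolding compatible_def by (intro ae_diagonal)
  \<comment> \<open>The condition \<open>first_one \<alpha>\<close> is included only for the case that there is no \<open>i\<close> below \<open>\<alpha>\<close>.\<close>
  define A where "A \<alpha> = insert (first_one \<alpha>) ((\<lambda>i. c i \<alpha>) ` elts \<alpha>)" for \<alpha>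
  define r where "r \<alpha> = (if compatible \<alpha> then vset (\<Union> (elts ` A \<alpha>)) else first_one \<alpha>)" for \<alpha>
  have A: "small (\<Union> (elts ` A \<alpha>))" "vset (\<Union> (elts ` A \<alpha>)) \<in> \<P>"
    if \<alpha>: "\<alpha> \<in> elts \<kappa>" and comp: "compatible \<alpha>" for \<alpha>
  proof -
    have "A \<alpha> \<subseteq> \<P>"
      using c_rooted(1) first_one_condition \<alpha> elts_subset[OF \<alpha>] by (auto simp: A_def)
    moreover have "A \<alpha> \<prec> elts \<kappa>"
      unfolding A_def by (intro lesspoll_insert_infinite infinite image_lesspoll elts_lesspoll \<alpha>)
    moreover have "functional (elts p \<union> elts q)" if "p \<in> A \<alpha>" "q \<in> A \<alpha>" for p q
    proof -
      have root_union: "functional (elts (first_one \<alpha>) \<union> elts (c i \<alpha>))" if "i \<in> elts \<alpha>" for i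
        using c_rooted[of i \<alpha>] that \<alpha> elts_subset functional_condition
        by (metis subsetD sup.absorb2)
      show ?thesis
        using \<open>p \<in> A \<alpha>\<close> \<open>q \<in> A \<alpha>\<close> comp root_union functional_first_one[of \<alpha>]
        unfolding A_def compatible_def by (auto simp: Un_commute)
    qed
    then have "functional (\<Union> (elts ` A \<alpha>))"
      unfolding functional_def by blast
    ultimately show "small (\<Union> (elts ` A \<alpha>))" "vset (\<Union> (elts ` A \<alpha>)) \<in> \<P>"
      using union_condition by blast+
  qed
  have r: "\<Union> (elts ` A \<alpha>) = elts (r \<alpha>)" if "\<alpha> \<in> elts \<kappa>" "compatible \<alpha>" for \<alpha>
    using A(1)[OF that] that by (simp add: r_def)
  have "r \<in> rooted"
    unfolding rooted_def
  proof (intro CollectI ballI conjI)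
    fix \<alpha> assume \<alpha>: "\<alpha> \<in> elts \<kappa>"
    show "r \<alpha> \<in> \<P>"
      using A(2)[OF \<alpha>] first_one_condition[OF \<alpha>] by (simp add: r_def)
    show "elts (first_one \<alpha>) \<subseteq> elts (r \<alpha>)"
      using r[OF \<alpha>] by (cases "compatible \<alpha>") (auto simp: r_def A_def)
  qed
  moreover have "stronger r p" if "p \<in> C" for p
  proof -
    obtain i where i: "i \<in> elts \<kappa>" "p = c i"
      using c \<open>p \<in> C\<close> by blast
    have "\<forall>\<^sub>F \<alpha> in ae. elts (c i \<alpha>) \<subseteq> elts (r \<alpha>)"
      using compatible ae_above[OF i(1)] ae_in_cardinal
    proof eventually_elim
      case (elim \<alpha>)
      then show ?case
        using r[of \<alpha>] by (auto simp: A_def)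
    qed
    then show ?thesis
      by (simp add: stronger_def i(2))
  qed
  ultimately show ?thesis
    by blast
qed

end

sublocale normal_measure_on \<subseteq> forcing "cohen_conditions \<kappa>" "\<lambda>q p. elts p \<subseteq> elts q" "cohen_topology \<kappa>"
  by unfold_locales (auto simp: openin_cohen_topology small_conditions)

context normal_measure_on
begin

definition dense_opens :: "'v set set"
  where "dense_opens = {D. openin (cohen_topology \<kappa>) D \<and> (\<forall>p\<in>\<P>. \<exists>q\<in>D. elts p \<subseteq> elts q)}"

text \<open>
  There are at most \<open>2\<^sup>\<kappa>\<close> dense open sets of conditions, and \<open>2\<^sup>\<kappa>\<close> is the successor of \<open>\<kappa>\<close>.
\<close>

lemma generic_exists:
  assumes "ctwo ^c |elts \<kappa>| =o cardSuc |elts \<kappa>|"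
  obtains G where "G \<subseteq> rooted" "\<And>p q. p \<in> G \<Longrightarrow> q \<in> G \<Longrightarrow> stronger p q \<or> stronger q p"
    and "\<And>D. D \<in> dense_opens \<Longrightarrow> \<exists>q\<in>G. \<forall>\<^sub>F \<alpha> in ae. q \<alpha> \<in> D"
proof (rule generic_chain_exists[where Q=rooted and le=stronger and I=dense_opens and K="elts \<kappa>"
      and dense="\<lambda>D. {q. \<forall>\<^sub>F \<alpha> in ae. q \<alpha> \<in> D}"])
  have "|dense_opens| \<le>o |Pow \<P>|"
    by (intro card_of_mono1) (auto simp: dense_opens_def openin_iff)
  also have "|Pow \<P>| \<le>o |Pow (elts \<kappa>)|"
    using card_conditions unfolding card_of_ordLeq[symmetric]
    by (metis Pow_mono image_Pow_mono inj_on_image_Pow)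
  also have "|Pow (elts \<kappa>)| =o ctwo ^c |elts \<kappa>|"
    using card_of_Pow_Func by (simp add: cexp_def ctwo_def Field_card_of)
  also note assms
  finally show "|dense_opens| \<le>o cardSuc |elts \<kappa>|" .
next
  fix D q assume D: "D \<in> dense_opens" and q: "q \<in> rooted"
  have "\<forall>\<alpha>\<in>elts \<kappa>. \<exists>r\<in>D. elts (q \<alpha>) \<subseteq> elts r"
    using D q by (auto simp: dense_opens_def rooted_def)
  then obtain r where r: "\<And>\<alpha>. \<alpha> \<in> elts \<kappa> \<Longrightarrow> r \<alpha> \<in> D \<and> elts (q \<alpha>) \<subseteq> elts (r \<alpha>)"
    by metis
  have "r \<in> rooted"
    using D q r unfolding dense_opens_def rooted_def openin_iff by blast
  moreover have "\<forall>\<^sub>F \<alpha> in ae. r \<alpha> \<in> D" "stronger r q"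
    unfolding stronger_def using ae_in_cardinal by (eventually_elim, use r in blast)+
  ultimately show "\<exists>r\<in>rooted. r \<in> {q. \<forall>\<^sub>F \<alpha> in ae. q \<alpha> \<in> D} \<and> stronger r q"
    by blast
qed (use that rooted_closed stronger_refl in \<open>auto intro: stronger_trans\<close>)

end

section \<open>The ultrafilter induced by a generic chain\<close>

text \<open>
  A fixed generic chain. In terms of the ultrapower, \<open>generically B\<close> says that the element represented by
  \<open>B\<close>, a subset of the image forcing, meets the generic filter, and \<open>U\<close> is the preimage of that filter.
\<close>

locale generic_chain = normal_measure_on \<kappa> \<mu> for \<kappa> :: "'v::zfc_universe" and \<mu> +
  fixes G :: "('v \<Rightarrow> 'v) set"
  assumes rooted: "G \<subseteq> rooted"
    and chain: "p \<in> G \<Longrightarrow> q \<in> G \<Longrightarrow> stronger p q \<or> stronger q p"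
    and meets: "D \<in> dense_opens \<Longrightarrow> \<exists>q\<in>G. \<forall>\<^sub>F \<alpha> in ae. q \<alpha> \<in> D"
begin

abbreviation X :: "'v topology"
  where "X \<equiv> cohen_topology \<kappa>"

definition generically :: "('v \<Rightarrow> 'v set) \<Rightarrow> bool"
  where "generically B \<longleftrightarrow> (\<exists>q\<in>G. \<forall>\<^sub>F \<alpha> in ae. q \<alpha> \<in> B \<alpha>)"

definition U :: "'v set set"
  where "U = {b \<in> regular_opens X. generically (\<lambda>_. b)}"

lemma in_conditions: "q \<in> G \<Longrightarrow> \<forall>\<^sub>F \<alpha> in ae. \<alpha> \<in> elts \<kappa> \<and> q \<alpha> \<in> \<P>"
  using ae_in_cardinal by eventually_elim (use rooted in \<open>auto simp: rooted_def\<close>)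

lemma generically_ae_mono:
  assumes "generically B" "\<forall>\<^sub>F \<alpha> in ae. Q \<alpha>"
    and "\<And>\<alpha> p. \<alpha> \<in> elts \<kappa> \<Longrightarrow> p \<in> \<P> \<Longrightarrow> p \<in> B \<alpha> \<Longrightarrow> Q \<alpha> \<Longrightarrow> p \<in> C \<alpha>"
  shows "generically C"
proof -
  obtain q where q: "q \<in> G" "\<forall>\<^sub>F \<alpha> in ae. q \<alpha> \<in> B \<alpha>"
    using assms(1) generically_def by blast
  from q(2) assms(2) in_conditions[OF q(1)] have "\<forall>\<^sub>F \<alpha> in ae. q \<alpha> \<in> C \<alpha>"
    by eventually_elim (use assms(3) in blast)
  then show ?thesis
    unfolding generically_def using q(1) by blast
qed

lemma generically_mono:
  assumes "generically B"
    and "\<And>\<alpha> p. \<alpha> \<in> elts \<kappa> \<Longrightarrow> p \<in> \<P> \<Longrightarrow> p \<in> B \<alpha> \<Longrightarrow> p \<in> C \<alpha>"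
  shows "generically C"
  using generically_ae_mono[OF assms(1), of "\<lambda>_. True"] assms(2) by simp

lemma generically_imp_ae:
  assumes "generically B"
    and "\<And>\<alpha> p. \<alpha> \<in> elts \<kappa> \<Longrightarrow> p \<in> \<P> \<Longrightarrow> p \<in> B \<alpha> \<Longrightarrow> Q \<alpha>"
  shows "\<forall>\<^sub>F \<alpha> in ae. Q \<alpha>"
proof -
  obtain q where q: "q \<in> G" "\<forall>\<^sub>F \<alpha> in ae. q \<alpha> \<in> B \<alpha>"
    using assms(1) generically_def by blast
  from q(2) in_conditions[OF q(1)] show ?thesis
    by eventually_elim (use assms(2) in blast)
qed

text \<open>
  Of two members of the chain, the stronger one takes values in both open sets.
\<close>

lemma generically_Int:
  assumes "generically A" "generically B" "\<And>\<alpha>. openin X (A \<alpha>)" "\<And>\<alpha>. openin X (B \<alpha>)"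
  shows "generically (\<lambda>\<alpha>. A \<alpha> \<inter> B \<alpha>)"
proof -
  have *: "generically (\<lambda>\<alpha>. A \<alpha> \<inter> B \<alpha>)"
    if q: "q \<in> G" "stronger q p" "\<forall>\<^sub>F \<alpha> in ae. q \<alpha> \<in> A \<alpha>" "\<forall>\<^sub>F \<alpha> in ae. p \<alpha> \<in> B \<alpha>"
      and B: "\<And>\<alpha>. openin X (B \<alpha>)" for A B q p
  proof -
    have "\<forall>\<^sub>F \<alpha> in ae. q \<alpha> \<in> A \<alpha> \<inter> B \<alpha>"
      using q(3,4) q(2)[unfolded stronger_def] in_conditions[OF q(1)]
      by eventually_elim (use openin_mono[OF B] in blast)
    then show ?thesis
      unfolding generically_def using q(1) by blast
  qed
  obtain p q where pq: "p \<in> G" "\<forall>\<^sub>F \<alpha> in ae. p \<alpha> \<in> A \<alpha>" "q \<in> G" "\<forall>\<^sub>F \<alpha> in ae. q \<alpha> \<in> B \<alpha>"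
    using assms(1,2) generically_def by blast
  show ?thesis
    using chain[OF pq(1,3)]
  proof
    assume "stronger p q"
    then show ?thesis
      using * pq assms(4) by blast
  next
    assume "stronger q p"
    then have "generically (\<lambda>\<alpha>. B \<alpha> \<inter> A \<alpha>)"
      using * pq assms(3) by blast
    then show ?thesis
      by (simp add: Int_commute)
  qed
qed

lemma generically_dense: "D \<in> dense_opens \<Longrightarrow> generically (\<lambda>_. D)"
  unfolding generically_def by (rule meets)

lemma conditions_dense_open: "\<P> \<in> dense_opens"
  by (auto simp: dense_opens_def openin_iff)

text \<open>
  The usual way to decide \<open>b\<close>, refined so that a condition in \<open>b\<close> is extended into a set \<open>A\<close> that is
  dense below \<open>b\<close>.
\<close>

lemma dense_open_Un_neg:
  assumes "openin X A" "openin X b" "\<And>p. p \<in> b \<Longrightarrow> \<exists>q\<in>A. elts p \<subseteq> elts q"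
  shows "A \<union> ro_neg X b \<in> dense_opens"
  unfolding dense_opens_def
proof (intro CollectI conjI ballI)
  have "openin X (ro_neg X b)"
    by (simp add: ro_neg_def)
  then show "openin X (A \<union> ro_neg X b)"
    using assms(1) by (simp add: openin_Un)
  fix p assume "p \<in> \<P>"
  show "\<exists>q\<in>A \<union> ro_neg X b. elts p \<subseteq> elts q"
  proof (cases "p \<in> ro_neg X b")
    case False
    then obtain q where "q \<in> b" "elts p \<subseteq> elts q"
      using \<open>p \<in> \<P>\<close> by (auto simp: in_ro_neg_iff)
    then show ?thesis
      using assms(3) by blast
  qed blast
qed

lemma ultrafilter_U: "ultrafilter_on (regular_opens X) (ro_neg X) U"
  unfolding ultrafilter_on_def
proof (intro conjI ballI impI)
  show "U \<subseteq> regular_opens X"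
    by (auto simp: U_def)
  have "\<P> \<in> regular_opens X"
    by (auto simp: regular_opens_iff openin_iff)
  then show "U \<noteq> {}"
    using generically_dense[OF conditions_dense_open] by (auto simp: U_def)
  show "{} \<notin> U"
    using generically_imp_ae[of "\<lambda>_. {}" "\<lambda>_. False"] ae_not_False by (auto simp: U_def)
next
  fix a b assume "a \<in> U" "b \<in> U"
  then show "a \<inter> b \<in> U"
    using generically_Int[of "\<lambda>_. a" "\<lambda>_. b"] regular_open_Int regular_open_openin
    by (auto simp: U_def)
next
  fix a b assume "a \<in> U" "b \<in> regular_opens X" "a \<subseteq> b"
  then show "b \<in> U"
    using generically_mono[of "\<lambda>_. a" "\<lambda>_. b"] by (auto simp: U_def)
next
  fix b assume b: "b \<in> regular_opens X"
  then have "b \<union> ro_neg X b \<in> dense_opens"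
    using regular_open_openin by (intro dense_open_Un_neg) auto
  then obtain q where q: "q \<in> G" "\<forall>\<^sub>F \<alpha> in ae. q \<alpha> \<in> b \<union> ro_neg X b"
    using meets by blast
  have "(\<forall>\<^sub>F \<alpha> in ae. q \<alpha> \<in> b) \<or> (\<forall>\<^sub>F \<alpha> in ae. q \<alpha> \<notin> b)"
    by (rule ae_ultra)
  moreover have "\<forall>\<^sub>F \<alpha> in ae. q \<alpha> \<in> ro_neg X b" if "\<forall>\<^sub>F \<alpha> in ae. q \<alpha> \<notin> b"
    using q(2) that by eventually_elim blast
  ultimately show "b \<in> U \<or> ro_neg X b \<in> U"
    using q(1) b ro_neg_regular[OF regular_open_openin[OF b]]
    unfolding U_def generically_def by blast
qed

section \<open>The Boolean ultrapower and the classical ultrapower\<close>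

text \<open>
  In terms of the ultrapower: the value of the image of \<open>\<tau>\<close> under the generic filter is the element that
  \<open>f\<close> represents.
\<close>

definition represents :: "('v \<Rightarrow> 'v) \<Rightarrow> 'v \<Rightarrow> bool"
  where "represents f \<tau> \<longleftrightarrow> generically (\<lambda>\<alpha>. bval_eq X \<tau> (check_name X (f \<alpha>)))"

text \<open>
  Almost every value of a suitable member of the chain forces both \<open>\<tau>\<close> to equal \<open>f \<alpha>\<close> and \<open>\<sigma>\<close> to equal
  \<open>g \<alpha>\<close>. At such a condition \<open>\<tau> = \<sigma>\<close> is forced exactly if \<open>f \<alpha> = g \<alpha>\<close>, since equality of ground-model
  sets is absolute.
\<close>

lemma represents_eq_iff:
  assumes names: "is_name X \<tau>" "is_name X \<sigma>" and rep: "represents f \<tau>" "represents g \<sigma>"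
  shows "bval_eq X \<tau> \<sigma> \<in> U \<longleftrightarrow> up_eq \<kappa> \<mu> f g"
proof -
  note check = is_name_check_name
  have both: "generically (\<lambda>\<alpha>. bval_eq X \<tau> (check_name X (f \<alpha>)) \<inter> bval_eq X \<sigma> (check_name X (g \<alpha>)))"
    using rep bval_openin(3) unfolding represents_def by (intro generically_Int)
  show ?thesis
    unfolding up_eq_def eventually_ae[symmetric]
  proof
    assume "bval_eq X \<tau> \<sigma> \<in> U"
    then have "generically (\<lambda>_. bval_eq X \<tau> \<sigma>)"
      by (simp add: U_def)
    then have "generically (\<lambda>\<alpha>. bval_eq X \<tau> \<sigma> \<inter>
        (bval_eq X \<tau> (check_name X (f \<alpha>)) \<inter> bval_eq X \<sigma> (check_name X (g \<alpha>))))"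
      using both by (rule generically_Int) (intro openin_Int bval_openin)+
    then show "\<forall>\<^sub>F \<alpha> in ae. f \<alpha> = g \<alpha>"
    proof (rule generically_imp_ae)
      fix \<alpha> p assume p: "p \<in> bval_eq X \<tau> \<sigma> \<inter>
        (bval_eq X \<tau> (check_name X (f \<alpha>)) \<inter> bval_eq X \<sigma> (check_name X (g \<alpha>)))"
      then have "p \<in> bval_eq X (check_name X (f \<alpha>)) \<sigma>"
        using bval_eq_trans[OF check names, of p] bval_eq_sym by blast
      then have "p \<in> bval_eq X (check_name X (f \<alpha>)) (check_name X (g \<alpha>))"
        using bval_eq_trans[OF check names(2) check] p by blast
      then show "f \<alpha> = g \<alpha>"
        by (rule bval_eq_check_imp_eq)
    qed
  next
    assume "\<forall>\<^sub>F \<alpha> in ae. f \<alpha> = g \<alpha>"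
    with both have "generically (\<lambda>_. bval_eq X \<tau> \<sigma>)"
    proof (rule generically_ae_mono)
      fix \<alpha> p assume "p \<in> bval_eq X \<tau> (check_name X (f \<alpha>)) \<inter> bval_eq X \<sigma> (check_name X (g \<alpha>))"
        "f \<alpha> = g \<alpha>"
      then show "p \<in> bval_eq X \<tau> \<sigma>"
        using bval_eq_trans[OF names(1) check names(2)] bval_eq_sym by auto
    qed
    then show "bval_eq X \<tau> \<sigma> \<in> U"
      by (simp add: U_def bval_eq_regular)
  qed
qed

lemma represents_mem_iff:
  assumes names: "is_name X \<tau>" "is_name X \<sigma>" and rep: "represents f \<tau>" "represents g \<sigma>"
  shows "bval_mem X \<tau> \<sigma> \<in> U \<longleftrightarrow> up_mem \<kappa> \<mu> f g"
proof -
  note check = is_name_check_name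
  have both: "generically (\<lambda>\<alpha>. bval_eq X \<tau> (check_name X (f \<alpha>)) \<inter> bval_eq X \<sigma> (check_name X (g \<alpha>)))"
    using rep bval_openin(3) unfolding represents_def by (intro generically_Int)
  show ?thesis
    unfolding up_mem_def eventually_ae[symmetric]
  proof
    assume "bval_mem X \<tau> \<sigma> \<in> U"
    then have "generically (\<lambda>_. bval_mem X \<tau> \<sigma>)"
      by (simp add: U_def)
    then have "generically (\<lambda>\<alpha>. bval_mem X \<tau> \<sigma> \<inter>
        (bval_eq X \<tau> (check_name X (f \<alpha>)) \<inter> bval_eq X \<sigma> (check_name X (g \<alpha>))))"
      using both by (rule generically_Int) (intro openin_Int bval_openin)+
    then show "\<forall>\<^sub>F \<alpha> in ae. f \<alpha> \<in> elts (g \<alpha>)"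
    proof (rule generically_imp_ae)
      fix \<alpha> p assume "p \<in> \<P>" and p: "p \<in> bval_mem X \<tau> \<sigma> \<inter>
        (bval_eq X \<tau> (check_name X (f \<alpha>)) \<inter> bval_eq X \<sigma> (check_name X (g \<alpha>)))"
      then have "p \<in> bval_mem X (check_name X (f \<alpha>)) \<sigma>"
        using bval_mem_cong_left[OF names(1) check names(2)] by blast
      then have "p \<in> bval_mem X (check_name X (f \<alpha>)) (check_name X (g \<alpha>))"
        using bval_mem_cong_right[OF check names(2) check] p by blast
      then show "f \<alpha> \<in> elts (g \<alpha>)"
        using bval_mem_check_iff[OF \<open>p \<in> \<P>\<close>] by blast
    qed
  next
    assume "\<forall>\<^sub>F \<alpha> in ae. f \<alpha> \<in> elts (g \<alpha>)"
    with both have "generically (\<lambda>_. bval_mem X \<tau> \<sigma>)"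
    proof (rule generically_ae_mono)
      fix \<alpha> p assume "p \<in> \<P>" and p: "p \<in> bval_eq X \<tau> (check_name X (f \<alpha>)) \<inter> bval_eq X \<sigma> (check_name X (g \<alpha>))"
        and "f \<alpha> \<in> elts (g \<alpha>)"
      then have "p \<in> bval_mem X (check_name X (f \<alpha>)) (check_name X (g \<alpha>))"
        using bval_mem_check_iff by blast
      then have "p \<in> bval_mem X \<tau> (check_name X (g \<alpha>))"
        using bval_mem_cong_left[OF check names(1) check] bval_eq_sym p by blast
      then show "p \<in> bval_mem X \<tau> \<sigma>"
        using bval_mem_cong_right[OF names(1) check names(2)] bval_eq_sym p by blast
    qed
    then show "bval_mem X \<tau> \<sigma> \<in> U"
      by (simp add: U_def bval_mem_regular)
  qed
qed

lemma represents_in_bup_dom: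
  assumes "is_name X \<tau>" "represents f \<tau>"
  shows "\<tau> \<in> bup_dom X U"
proof -
  have "generically (\<lambda>_. bval_ground X \<tau>)"
    using assms(2) unfolding represents_def
    by (rule generically_mono) (use bval_eq_subset_ground in blast)
  then show ?thesis
    using assms(1) by (simp add: bup_dom_def U_def bval_ground_regular)
qed

lemma represents_check_name: "represents (\<lambda>\<alpha>\<in>elts \<kappa>. x) (check_name X x)"
  unfolding represents_def
  by (rule generically_mono[OF generically_dense[OF conditions_dense_open]]) (simp add: bval_eq_refl)

text \<open>
  The conditions that force \<open>\<tau>\<close> to equal a particular ground-model set are dense below the value of
  "\<open>\<tau>\<close> is in the ground model". Since the latter is in \<open>U\<close>, some member of the chain consists of such
  conditions almost everywhere, and \<open>f\<close> reads off the sets that they decide.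
\<close>

lemma represented_by_function:
  assumes "\<tau> \<in> bup_dom X U"
  obtains f where "f \<in> up_dom \<kappa>" "represents f \<tau>"
proof -
  let ?A = "\<Union>x. bval_eq X \<tau> (check_name X x)"
  have "?A \<union> ro_neg X (bval_ground X \<tau>) \<in> dense_opens"
  proof (rule dense_open_Un_neg)
    show "openin X ?A"
      using bval_openin(3) by blast
    show "openin X (bval_ground X \<tau>)"
      using bval_ground_regular regular_open_openin by blast
    show "\<exists>q\<in>?A. elts p \<subseteq> elts q" if "p \<in> bval_ground X \<tau>" for p
    proof -
      have "p \<in> \<P>" "\<forall>q\<in>\<P>. elts p \<subseteq> elts q \<longrightarrow> (\<exists>r\<in>\<P>. elts q \<subseteq> elts r \<and> r \<in> ?A)"
        using that unfolding bval_ground_def in_ro_Sup_iff by simp_all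
      then show ?thesis
        by blast
    qed
  qed
  then have "generically (\<lambda>_. (?A \<union> ro_neg X (bval_ground X \<tau>)) \<inter> bval_ground X \<tau>)"
    using generically_dense assms bval_ground_regular regular_open_openin
    by (intro generically_Int) (auto simp: bup_dom_def U_def dense_opens_def)
  then have "generically (\<lambda>_. ?A)"
    by (rule generically_mono) (auto simp: in_ro_neg_iff)
  then obtain q where q: "q \<in> G" "\<forall>\<^sub>F \<alpha> in ae. q \<alpha> \<in> ?A"
    unfolding generically_def by blast
  define f where "f = (\<lambda>\<alpha>\<in>elts \<kappa>. SOME x. q \<alpha> \<in> bval_eq X \<tau> (check_name X x))"
  have "\<forall>\<^sub>F \<alpha> in ae. q \<alpha> \<in> bval_eq X \<tau> (check_name X (f \<alpha>))"
    using q(2) ae_in_cardinal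
  proof eventually_elim
    case (elim \<alpha>)
    then have "\<exists>x. q \<alpha> \<in> bval_eq X \<tau> (check_name X x)"
      by blast
    then show ?case
      unfolding f_def restrict_apply'[OF elim(2)] by (rule someI_ex)
  qed
  then have "represents f \<tau>"
    unfolding represents_def generically_def using q(1) by blast
  moreover have "f \<in> up_dom \<kappa>"
    by (simp add: f_def up_dom_def)
  ultimately show thesis
    using that by blast
qed

text \<open>
  Mixing the sets \<open>f \<alpha>\<close> along the antichain of the conditions \<open>first_one \<alpha>\<close> gives a name for \<open>f\<close> applied to
  the first place with value \<open>1\<close>. Every rooted function decides this place to be \<open>\<alpha>\<close> at coordinate \<open>\<alpha>\<close>.
\<close>

lemma function_represents_name:
  obtains \<tau> where "is_name X \<tau>" "represents f \<tau>"
proof -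
  let ?cone = "\<lambda>\<alpha>. {q \<in> \<P>. elts (first_one \<alpha>) \<subseteq> elts q}"
  have disj: "ro_Sup X {?cone \<alpha>} \<inter> ro_Sup X {?cone \<beta>} = {}"
    if "\<alpha> \<in> elts \<kappa>" "\<beta> \<in> elts \<kappa>" "\<alpha> \<noteq> \<beta>" for \<alpha> \<beta>
  proof (intro ro_Sup_disjoint openin_cone equals0I)
    fix q assume "q \<in> ?cone \<alpha> \<inter> ?cone \<beta>"
    then show False
      using first_one_incompatible[OF that functional_condition[of q]] by blast
  qed
  obtain \<tau> where \<tau>: "is_name X \<tau>"
    "\<And>\<alpha>. \<alpha> \<in> elts \<kappa> \<Longrightarrow> ro_Sup X {?cone \<alpha>} \<subseteq> bval_eq X \<tau> (check_name X (f \<alpha>))"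
    using mixing_exists[where I="elts \<kappa>" and b="\<lambda>\<alpha>. ro_Sup X {?cone \<alpha>}" and f=f,
      OF small_elts ro_Sup_regular disj] by blast
  \<comment> \<open>Taking \<open>ro_Sup\<close> makes the cone a regular open set.\<close>
  have cone: "?cone \<alpha> \<subseteq> ro_Sup X {?cone \<alpha>}" for \<alpha>
    unfolding ro_Sup_def
    by (intro interior_of_maximal openin_cone) (simp add: closure_of_subset topspace_eq Collect_restrict)
  obtain q where q: "q \<in> G"
    using meets[OF conditions_dense_open] by blast
  have "\<forall>\<^sub>F \<alpha> in ae. q \<alpha> \<in> bval_eq X \<tau> (check_name X (f \<alpha>))"
    using ae_in_cardinal
  proof eventually_elim
    case (elim \<alpha>)
    then have "q \<alpha> \<in> ?cone \<alpha>"
      using q rooted by (auto simp: rooted_def)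
    then show ?case
      using cone \<tau>(2)[OF elim] by blast
  qed
  then have "represents f \<tau>"
    unfolding represents_def generically_def using q by blast
  then show thesis
    using that \<tau>(1) by blast
qed

lemma wf_and_embedding:
  shows "wf (bup_mem_rel X U)" and "bup_embedding X U = up_embedding \<kappa> \<mu>"
proof -
  let ?R = "\<lambda>\<tau> f. represents f \<tau>"
  have name: "is_name X \<tau>" if "\<tau> \<in> bup_dom X U" for \<tau>
    using that by (simp add: bup_dom_def)
  have eq: "bval_eq X \<tau> \<sigma> \<in> U \<longleftrightarrow> up_eq \<kappa> \<mu> f g"
    if "\<tau> \<in> bup_dom X U" "\<sigma> \<in> bup_dom X U" "represents f \<tau>" "represents g \<sigma>" for \<tau> \<sigma> f g
    using represents_eq_iff name that by blast
  have mem: "bval_mem X \<tau> \<sigma> \<in> U \<longleftrightarrow> up_mem \<kappa> \<mu> f g"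
    if "\<tau> \<in> bup_dom X U" "\<sigma> \<in> bup_dom X U" "represents f \<tau>" "represents g \<sigma>" for \<tau> \<sigma> f g
    using represents_mem_iff name that by blast
  have total: "\<exists>f\<in>up_dom \<kappa>. represents f \<tau>" if "\<tau> \<in> bup_dom X U" for \<tau>
    using represented_by_function[OF that] by blast
  have onto: "\<exists>\<tau>\<in>bup_dom X U. represents f \<tau>" for f
    using function_represents_name[of f] represents_in_bup_dom by blast
  let ?eq = "\<lambda>\<tau> \<sigma>. bval_eq X \<tau> \<sigma> \<in> U" and ?mem = "\<lambda>\<tau> \<sigma>. bval_mem X \<tau> \<sigma> \<in> U"
  note correspondence = quotient_correspondence[of "bup_dom X U" "up_dom \<kappa>" ?R ?eq "up_eq \<kappa> \<mu>"
      ?mem "up_mem \<kappa> \<mu>", OF _ _ _ _ quot_class_up_eq_iff wf_ultrapower]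
  have wf: "wf (quot_mem (bup_dom X U) ?eq ?mem)"
    by (rule correspondence(1)) (use eq mem total onto in \<open>assumption | blast\<close>)+
  have collapse: "collapse (quot_mem (bup_dom X U) ?eq ?mem) (quot_class (bup_dom X U) ?eq \<tau>) =
      (collapse (quot_mem (up_dom \<kappa>) (up_eq \<kappa> \<mu>) (up_mem \<kappa> \<mu>))
        (quot_class (up_dom \<kappa>) (up_eq \<kappa> \<mu>) f) :: 'v)"
    if "\<tau> \<in> bup_dom X U" "f \<in> up_dom \<kappa>" "represents f \<tau>" for \<tau> f
    using that
    by (intro correspondence(2)) (use eq mem total onto in \<open>assumption | blast\<close>)+
  show "wf (bup_mem_rel X U)"
    unfolding bup_mem_rel_def by (rule wf)
  show "bup_embedding X U = up_embedding \<kappa> \<mu>"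
  proof
    fix x
    have 1: "check_name X x \<in> bup_dom X U"
      by (rule represents_in_bup_dom[OF is_name_check_name represents_check_name])
    have 2: "(\<lambda>\<alpha>\<in>elts \<kappa>. x) \<in> up_dom \<kappa>"
      by (simp add: up_dom_def)
    show "bup_embedding X U x = up_embedding \<kappa> \<mu> x"
      unfolding bup_embedding_def up_embedding_def bup_mem_rel_def
      by (rule collapse[OF 1 2 represents_check_name])
  qed
qed

end

theorem corollary81:
  fixes \<kappa> :: "'v::zfc_universe" and \<mu> :: "'v set set"
  assumes "measurable_cardinal \<kappa>"
    and "ctwo ^c |elts \<kappa>| =o cardSuc |elts \<kappa>|"
    and "normal_measure \<kappa> \<mu>"
  shows "\<exists>U. well_founded_ultrafilter (cohen_topology \<kappa>) U \<and>
    bup_embedding (cohen_topology \<kappa>) U = up_embedding \<kappa> \<mu>"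
proof -
  interpret normal_measure_on \<kappa> \<mu>
    using assms(1,3) by unfold_locales (simp_all add: measurable_cardinal_def)
  obtain G where G: "G \<subseteq> rooted" "\<And>p q. p \<in> G \<Longrightarrow> q \<in> G \<Longrightarrow> stronger p q \<or> stronger q p"
    "\<And>D. D \<in> dense_opens \<Longrightarrow> \<exists>q\<in>G. \<forall>\<^sub>F \<alpha> in ae. q \<alpha> \<in> D"
    using generic_exists[OF assms(2)] by blast
  interpret generic_chain \<kappa> \<mu> G
    using G by unfold_locales
  show ?thesis
    using ultrafilter_U wf_and_embedding unfolding well_founded_ultrafilter_def by blast
qed

end
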